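(* For each real $p$ with $0 < p \le 2$ there exists $\varepsilon_p > 0$ such that for all $f \in H^p(\mathbb{T})$, with Taylor expansion $f(z) = a_0 + a_1 z + a_2 z^2 + \ldots$, we have $$|a_0|^2 + \frac{p}{2}|a_1|^2 + \varepsilon_p \sum_{n=2}^\infty \frac{|a_n|^2}{(n+1)^{2/p-1}} \le \|f\|_p^2.$$
   Context: $H^p(\mathbb{T})$ is the Hardy space of the unit circle, identified with the space of analytic functions $f$ on the open unit disc $\mathbb{D}$ such that $\|f\|_p = \sup_{0<r<1}\left(\frac{1}{2\pi}\int_0^{2\pi}|f(re^{it})|^p\,dt\right)^{1/p} < \infty$ (equivalently, $\|f\|_p$ is the $L^p$ norm of the boundary values with respect to normalized arc length; for $p<1$ it is only a quasi-norm). The $a_n$ are the Taylor coefficients of $f$ at $0$. The constant $\varepsilon_p$ depends only on $p$. *)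

theory Defs
  imports "HOL-Complex_Analysis.Complex_Analysis"
begin

definition hardy_mean :: "real \<Rightarrow> (complex \<Rightarrow> complex) \<Rightarrow> real \<Rightarrow> real" where
  "hardy_mean p f r =
     (1 / (2 * pi) * integral {0..2 * pi} (\<lambda>t. norm (f (of_real r * cis t)) powr p)) powr (1 / p)"

(* Elements of H^p are functions on the whole complex type, but only their restriction to the
   open unit disc matters: no notion below depends on the values outside it.  The library's real
   Sup is meaningful only for bounded sets, so finiteness of the supremum is expressed as
   boundedness of the means, and hardy_norm is used only on hardy_space. *)
definition hardy_space :: "real \<Rightarrow> (complex \<Rightarrow> complex) set" where
  "hardy_space p = {f. f holomorphic_on ball 0 1 \<and> bdd_above (hardy_mean p f ` {0<..<1})}"

definition hardy_norm :: "real \<Rightarrow> (complex \<Rightarrow> complex) \<Rightarrow> real" where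
  "hardy_norm p f = (SUP r\<in>{0<..<1}. hardy_mean p f r)"

definition taylor_coeff :: "(complex \<Rightarrow> complex) \<Rightarrow> nat \<Rightarrow> complex" where
  "taylor_coeff f n = fps_nth (fps_expansion f 0) n"

end

theory Submission
  imports Defs
begin

text \<open>
  Put \<open>\<alpha> = 2 / p\<close>.  For \<open>p = 2\<close> the inequality is Parseval's identity, so let \<open>\<alpha> > 1\<close>.  Replacing
  \<open>f z\<close> by \<open>f (r z)\<close> with \<open>r < 1\<close>, one may assume that \<open>f\<close> is holomorphic beyond the closed disc and
  has no zeros on the circle; letting \<open>r\<close> tend to \<open>1\<close> at the end recovers the general case.  Then
  \<open>f = c B h\<^sup>\<alpha>\<close> with a finite Blaschke product \<open>B\<close> and a zero-free \<open>h = exp l\<close>, \<open>h 0 = 1\<close>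
  (\<open>blaschke_factorization\<close>).  Since \<open>|f|\<^sup>p = |c|\<^sup>p |h|\<^sup>2\<close> on the circle, the squared norm of \<open>f\<close> is
  \<open>|c|\<^sup>2 S\<^sup>\<alpha>\<close>, where \<open>S = 1 + y + R\<close> is the squared \<open>H\<^sup>2\<close> norm of \<open>h\<close>, with \<open>y = |h\<^sub>1|\<^sup>2\<close> and \<open>R\<close> the sum
  of the \<open>|h\<^sub>n|\<^sup>2\<close> for \<open>n \<ge> 2\<close>.  By homogeneity take \<open>c = 1\<close>.

  Suppose first that \<open>B = 1\<close>, so \<open>f = h\<^sup>\<alpha>\<close>.  Here \<open>f\<^sub>0 = 1\<close> and \<open>f\<^sub>1 = \<alpha> h\<^sub>1\<close>, so the first two terms of
  the inequality add up to \<open>1 + \<alpha> y\<close> and the tail must be controlled by the gap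
  \<open>E = S\<^sup>\<alpha> - 1 - \<alpha> y\<close>.  From \<open>f' = \<alpha> h\<^sup>\<beta> h'\<close> with \<open>\<beta> = \<alpha> - 1\<close> one gets
  \<open>f' - f\<^sub>1 = \<alpha> (h\<^sup>\<beta> (h' - h\<^sub>1) + h\<^sub>1 (h\<^sup>\<beta> - 1))\<close>.  As \<open>|h z|\<^sup>2 \<le> S / (1 - |z|\<^sup>2)\<close>, multiplication by
  \<open>h\<^sup>\<beta>\<close> costs only a factor \<open>S\<^sup>\<beta>\<close> if the weight on the coefficients is lowered by \<open>\<beta>\<close> powers of
  \<open>n\<close> (\<open>exp_multiplier_weighted\<close>).  So the two pieces contribute at most constant multiples of
  \<open>S powr \<beta> * R\<close> and of \<open>y * S powr (\<beta> - 1) * (S - 1)\<close> (\<open>exp_power_tail\<close>).  Convexity of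
  \<open>x\<^sup>\<alpha>\<close>, in a quantitative form, shows that \<open>E\<close> dominates both (\<open>powr_deficit_dominates\<close>).

  In general write \<open>f = B g\<close> with \<open>g = h\<^sup>\<alpha>\<close>, and let \<open>b\<close> be the modulus of \<open>B 0\<close>.  The Schwarz-Pick
  bound \<open>|B\<^sub>1| \<le> 1 - b\<^sup>2\<close> shows that passing from \<open>g\<close> to \<open>B g\<close> lowers the first two terms by at least
  a constant times \<open>(1 - b\<^sup>2) (1 + |g\<^sub>1|\<^sup>2)\<close> (\<open>multiplier_deficit\<close>), the constant being positive because \<open>\<alpha> > 1\<close>.
  That pays for the terms of degree at least two in \<open>B (1 + g\<^sub>1 z)\<close>, because \<open>B - B 0\<close> has squared
  \<open>H\<^sup>2\<close> norm at most \<open>1 - b\<^sup>2\<close>; and \<open>B\<close> times the tail of \<open>g\<close> is no larger than the tail of \<open>g\<close>, as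
  the weights decrease (\<open>multiplier_tail\<close>).
\<close>

section \<open>Taylor coefficients\<close>

lemma has_fps_expansion_taylor:
  assumes "f holomorphic_on ball 0 \<rho>" "0 < \<rho>"
  shows "f has_fps_expansion fps_expansion f 0"
  using assms by (intro has_fps_expansion_fps_expansion[of "ball 0 \<rho>"]) auto

lemma taylor_coeff_eqI:
  assumes "f has_fps_expansion F"
  shows "taylor_coeff f n = fps_nth F n"
  using fps_expansion_eqI[OF assms] by (simp add: taylor_coeff_def)

lemma taylor_coeff_sums:
  assumes "f holomorphic_on ball 0 \<rho>" "norm z < \<rho>"
  shows "(\<lambda>n. taylor_coeff f n * z ^ n) sums f z"
  using holomorphic_power_series[OF assms(1), of z] assms(2)
  by (simp add: taylor_coeff_def fps_expansion_def)

lemma taylor_coeff_0: "taylor_coeff f 0 = f 0"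
  by (simp add: taylor_coeff_def fps_expansion_def)

lemma taylor_coeff_mult:
  assumes "f holomorphic_on ball 0 \<rho>" "g holomorphic_on ball 0 \<rho>" "0 < \<rho>"
  shows "taylor_coeff (\<lambda>z. f z * g z) n = (\<Sum>i\<le>n. taylor_coeff f i * taylor_coeff g (n - i))"
  using taylor_coeff_eqI[OF has_fps_expansion_mult[OF has_fps_expansion_taylor has_fps_expansion_taylor]] assms
  by (simp add: fps_mult_nth taylor_coeff_def atLeast0AtMost)

lemma taylor_coeff_cmult:
  assumes "f holomorphic_on ball 0 \<rho>" "0 < \<rho>"
  shows "taylor_coeff (\<lambda>z. c * f z) n = c * taylor_coeff f n"
  using taylor_coeff_eqI[OF has_fps_expansion_cmult_left[OF has_fps_expansion_taylor]] assms
  by (simp add: taylor_coeff_def)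

lemma taylor_coeff_add:
  assumes "f holomorphic_on ball 0 \<rho>" "g holomorphic_on ball 0 \<rho>" "0 < \<rho>"
  shows "taylor_coeff (\<lambda>z. f z + g z) n = taylor_coeff f n + taylor_coeff g n"
  using taylor_coeff_eqI[OF has_fps_expansion_add[OF has_fps_expansion_taylor has_fps_expansion_taylor]] assms
  by (simp add: taylor_coeff_def)

lemma taylor_coeff_diff:
  assumes "f holomorphic_on ball 0 \<rho>" "g holomorphic_on ball 0 \<rho>" "0 < \<rho>"
  shows "taylor_coeff (\<lambda>z. f z - g z) n = taylor_coeff f n - taylor_coeff g n"
  using taylor_coeff_eqI[OF has_fps_expansion_diff[OF has_fps_expansion_taylor has_fps_expansion_taylor]] assms
  by (simp add: taylor_coeff_def)

lemma taylor_coeff_const: "taylor_coeff (\<lambda>z. c) n = (if n = 0 then c else 0)"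
  by (subst taylor_coeff_eqI[OF has_fps_expansion_const]) auto

lemma taylor_coeff_deriv:
  assumes "f holomorphic_on ball 0 \<rho>" "0 < \<rho>"
  shows "taylor_coeff (deriv f) n = of_nat (Suc n) * taylor_coeff f (Suc n)"
  using taylor_coeff_eqI[OF has_fps_expansion_deriv[OF has_fps_expansion_taylor[OF assms]]]
  by (simp add: taylor_coeff_def)

lemma taylor_coeff_cong:
  assumes "\<And>z. norm z < \<rho> \<Longrightarrow> f z = g z" "0 < \<rho>"
  shows "taylor_coeff f n = taylor_coeff g n"
proof -
  have "\<forall>\<^sub>F z in nhds 0. f z = g z"
    using eventually_nhds_in_open[of "ball 0 \<rho>" 0] assms by (auto elim!: eventually_mono)
  then show ?thesis
    using fps_expansion_cong by (metis taylor_coeff_def)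
qed

lemma taylor_coeff_dilate:
  assumes "f holomorphic_on ball 0 \<rho>" "0 < r" "0 < \<rho>"
  shows "taylor_coeff (\<lambda>z. f (of_real r * z)) n = of_real (r ^ n) * taylor_coeff f n"
proof -
  have "(\<lambda>n. of_real (r ^ n) * taylor_coeff f n * z ^ n) sums f (of_real r * z)" if "norm z < \<rho> / r" for z
    using taylor_coeff_sums[OF assms(1), of "of_real r * z"] that assms
    by (auto simp: norm_mult power_mult_distrib field_simps)
  then have "(\<lambda>z. f (of_real r * z)) has_fps_expansion Abs_fps (\<lambda>n. of_real (r ^ n) * taylor_coeff f n)"
    using assms
    by (intro has_fps_expansionI eventually_mono[OF eventually_nhds_in_open[of "ball 0 (\<rho> / r)" 0]]) auto
  from taylor_coeff_eqI[OF this] show ?thesis by simp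
qed

section \<open>Circle means and Parseval's identity\<close>

definition circle_mean :: "(complex \<Rightarrow> real) \<Rightarrow> real" where
  "circle_mean u = 1 / (2 * pi) * integral {0..2 * pi} (\<lambda>t. u (cis t))"

lemma circle_integrable:
  fixes u :: "complex \<Rightarrow> 'a :: euclidean_space"
  assumes "continuous_on (sphere 0 1) u"
  shows "(\<lambda>t. u (cis t)) integrable_on {0..2 * pi}"
  by (intro integrable_continuous_real continuous_on_compose2[OF assms] continuous_intros) auto

lemma circle_mean_mono:
  assumes "continuous_on (sphere 0 1) u" "continuous_on (sphere 0 1) v"
    and "\<And>z. norm z = 1 \<Longrightarrow> u z \<le> v z"
  shows "circle_mean u \<le> circle_mean v"
  unfolding circle_mean_def
  by (intro mult_left_mono integral_le circle_integrable assms) (use assms in auto)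

lemma circle_mean_cong:
  assumes "\<And>z. norm z = 1 \<Longrightarrow> u z = v z"
  shows "circle_mean u = circle_mean v"
  unfolding circle_mean_def using assms by simp

lemma circle_mean_cmult: "circle_mean (\<lambda>z. c * u z) = c * circle_mean u"
  by (simp add: circle_mean_def)

lemma circle_mean_affine:
  assumes "continuous_on (sphere 0 1) u"
  shows "circle_mean (\<lambda>z. c + d * u z) = c + d * circle_mean u"
proof -
  have "((\<lambda>t. c + d * u (cis t)) has_integral c * (2 * pi) + d * integral {0..2 * pi} (\<lambda>t. u (cis t))) {0..2 * pi}"
    using has_integral_const_real[of c 0 "2 * pi"] circle_integrable[OF assms]
    by (intro has_integral_add has_integral_mult_right) (auto simp: mult.commute has_integral_integral)
  then show ?thesis
    unfolding circle_mean_def by (simp add: integral_unique field_simps)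
qed

lemma circle_mean_nonneg:
  assumes "\<And>z. norm z = 1 \<Longrightarrow> u z \<ge> 0"
  shows "circle_mean u \<ge> 0"
  unfolding circle_mean_def
  by (cases "(\<lambda>t. u (cis t)) integrable_on {0..2*pi}")
     (auto simp: not_integrable_integral assms intro!: divide_nonneg_pos integral_nonneg)

lemma hardy_mean_eq: 
  "hardy_mean p f r = circle_mean (\<lambda>z. norm (f (of_real r * z)) powr p) powr (1 / p)"
  by (simp add: hardy_mean_def circle_mean_def)

lemma has_integral_cis_int:
  "((\<lambda>t. cis (of_int k * t)) has_integral (if k = 0 then 2 * pi else 0)) {0..2 * pi}"
proof (cases "k = 0")
  case True
  then show ?thesis using has_integral_const_real[of "1::complex" 0 "2 * pi"] by (simp add: scaleR_conv_of_real)
next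
  case False
  have "((\<lambda>t. cis (of_int k * t)) has_integral
      (cis (of_int k * (2 * pi)) / (\<i> * of_int k) - cis (of_int k * 0) / (\<i> * of_int k))) {0..2 * pi}"
  proof (rule fundamental_theorem_of_calculus)
    fix t :: real
    have eq: "cis (of_int k * t) = exp (\<i> * of_int k * of_real t)" for t
      by (simp add: cis_conv_exp mult_ac)
    have "((\<lambda>z. exp (\<i> * of_int k * z) / (\<i> * of_int k)) has_field_derivative exp (\<i> * of_int k * of_real t)) (at (of_real t))"
      using False by (auto intro!: derivative_eq_intros)
    from has_vector_derivative_real_field[OF this]
    show "((\<lambda>t. cis (of_int k * t) / (\<i> * of_int k)) has_vector_derivative cis (of_int k * t)) (at t within {0..2 * pi})"
      unfolding eq by (simp add: o_def)
  qed auto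
  moreover have "cis (of_int k * (2 * pi)) = 1"
    by (metis cis_multiple_2pi Ints_of_int mult.commute)
  ultimately show ?thesis using False by simp
qed

lemma circle_mean_norm_square_poly:
  "circle_mean (\<lambda>z. (norm (\<Sum>n<N. a n * z ^ n))\<^sup>2) = (\<Sum>n<N. (norm (a n))\<^sup>2)"
proof -
  have eq: "complex_of_real ((norm (\<Sum>n<N. a n * cis t ^ n))\<^sup>2)
      = (\<Sum>n<N. \<Sum>m<N. a n * cnj (a m) * cis (of_int (int n - int m) * t))" for t
  proof -
    have "cis (of_int (int n - int m) * t) = cis t ^ n * cnj (cis t ^ m)" for n m
      unfolding complex_cnj_power cis_cnj Complex.DeMoivre cis_mult
      by (rule arg_cong[where f = cis]) (simp add: algebra_simps)
    then show ?thesis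
      unfolding complex_norm_square by (simp add: sum_product mult_ac)
  qed
  have "((\<lambda>t. complex_of_real ((norm (\<Sum>n<N. a n * cis t ^ n))\<^sup>2)) has_integral
     (\<Sum>n<N. \<Sum>m<N. a n * cnj (a m) * (if int n - int m = 0 then 2 * pi else 0))) {0..2 * pi}"
    unfolding eq by (intro has_integral_sum has_integral_mult_right has_integral_cis_int) auto
  also have "(\<Sum>n<N. \<Sum>m<N. a n * cnj (a m) * (if int n - int m = 0 then 2 * pi else 0))
      = complex_of_real (2 * pi * (\<Sum>n<N. (norm (a n))\<^sup>2))"
    by (simp add: complex_norm_square if_distrib sum.delta sum_distrib_left mult_ac
             del: of_real_power cong: if_cong)
  finally have "((\<lambda>t. (norm (\<Sum>n<N. a n * cis t ^ n))\<^sup>2) has_integral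
     (2 * pi * (\<Sum>n<N. (norm (a n))\<^sup>2))) {0..2 * pi}"
    by (drule_tac has_integral_linear[OF _ bounded_linear_Re]) (simp only: o_def Re_complex_of_real)
  then show ?thesis
    by (simp add: circle_mean_def integral_unique)
qed

lemma continuous_on_circle_dilate:
  assumes "f holomorphic_on ball 0 \<rho>" "0 \<le> r" "r < \<rho>"
  shows "continuous_on (sphere 0 1) (\<lambda>z. f (of_real r * z))"
  by (rule continuous_on_compose2[OF holomorphic_on_imp_continuous_on[OF assms(1)]])
     (use assms in \<open>auto intro!: continuous_intros simp: norm_mult\<close>)

text \<open>The partial sums are bounded on the circle of radius \<open>r\<close> by the sum of the moduli of their
  coefficients, so their mean squares converge to that of \<open>f\<close> by dominated convergence.\<close>

lemma parseval:
  assumes "f holomorphic_on ball 0 \<rho>" "0 \<le> r" "r < \<rho>"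
  shows "(\<lambda>n. (norm (taylor_coeff f n))\<^sup>2 * (r\<^sup>2) ^ n) sums circle_mean (\<lambda>z. (norm (f (of_real r * z)))\<^sup>2)"
proof -
  define a where "a n = taylor_coeff f n * of_real r ^ n" for n
  define P where "P N z = (\<Sum>n<N. a n * z ^ n)" for N z
  have sm: "summable (\<lambda>n. norm (a n))"
  proof -
    \<comment> \<open>convergence at a slightly larger radius gives absolute convergence at \<open>r\<close>\<close>
    obtain s where s: "r < s" "s < \<rho>" using assms dense by blast
    have "summable (\<lambda>n. taylor_coeff f n * of_real s ^ n)"
      using taylor_coeff_sums[OF assms(1), of "of_real s"] s assms by (auto simp: sums_iff)
    from powser_insidea[OF this, of "of_real r"] show ?thesis
      using s assms by (simp add: a_def)
  qed
  have lim: "(\<lambda>N. P N z) \<longlonglongrightarrow> f (of_real r * z)" if "norm z = 1" for z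
    using taylor_coeff_sums[OF assms(1), of "of_real r * z"] that assms
    by (simp add: sums_def P_def a_def norm_mult power_mult_distrib mult_ac)
  have bd: "norm (P N z) \<le> (\<Sum>n. norm (a n))" if "norm z = 1" for N z
  proof -
    have "norm (P N z) \<le> (\<Sum>n<N. norm (a n))"
      unfolding P_def by (rule order.trans[OF norm_sum]) (simp add: norm_mult norm_power that)
    also have "\<dots> \<le> (\<Sum>n. norm (a n))"
      by (intro sum_le_suminf sm) auto
    finally show ?thesis .
  qed
  have "(\<lambda>N. integral {0..2 * pi} (\<lambda>t. (norm (P N (cis t)))\<^sup>2))
          \<longlonglongrightarrow> integral {0..2 * pi} (\<lambda>t. (norm (f (of_real r * cis t)))\<^sup>2)"
  proof (rule dominated_convergence)
    show "(\<lambda>t. (norm (P N (cis t)))\<^sup>2) integrable_on {0..2 * pi}" for N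
      unfolding P_def by (intro integrable_continuous_real continuous_intros)
    show "(\<lambda>t. (\<Sum>n. norm (a n))\<^sup>2) integrable_on {0..2 * pi}"
      by (intro integrable_continuous_real continuous_intros)
    show "norm ((norm (P N (cis t)))\<^sup>2) \<le> (\<Sum>n. norm (a n))\<^sup>2" for N t
      using bd[of "cis t" N] by (simp add: power_mono)
    show "(\<lambda>N. (norm (P N (cis t)))\<^sup>2) \<longlonglongrightarrow> (norm (f (of_real r * cis t)))\<^sup>2" for t
      by (intro tendsto_intros lim) auto
  qed
  then have "(\<lambda>N. circle_mean (\<lambda>z. (norm (P N z))\<^sup>2)) \<longlonglongrightarrow> circle_mean (\<lambda>z. (norm (f (of_real r * z)))\<^sup>2)"
    unfolding circle_mean_def by (intro tendsto_intros)
  then have "(\<lambda>n. (norm (a n))\<^sup>2) sums circle_mean (\<lambda>z. (norm (f (of_real r * z)))\<^sup>2)"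
    unfolding P_def circle_mean_norm_square_poly sums_def .
  then show ?thesis
    using assms by (simp add: a_def norm_mult norm_power power_mult_distrib power_even_eq mult.commute flip: power_mult)
qed

lemma parseval_unit:
  assumes "f holomorphic_on ball 0 \<rho>" "1 < \<rho>"
  shows "(\<lambda>n. (norm (taylor_coeff f n))\<^sup>2) sums circle_mean (\<lambda>z. (norm (f z))\<^sup>2)"
  using parseval[of f \<rho> 1] assms by simp

section \<open>Multipliers bounded by one on the circle\<close>

text \<open>The coefficients up to \<open>N\<close> of a product depend only on the coefficients up to \<open>N\<close> of the factors.
  So the series with coefficients \<open>c\<close> may be replaced by its \<open>N\<close>-th section \<open>q\<close>, and \<open>B\<close> does not
  increase the mean square of \<open>q\<close> on the circle.\<close>

lemma multiplier_partial_sums: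
  assumes B: "B holomorphic_on ball 0 \<rho>" "1 < \<rho>" "\<And>z. norm z = 1 \<Longrightarrow> norm (B z) \<le> 1"
  shows "(\<Sum>n\<le>N. (norm (\<Sum>i\<le>n. taylor_coeff B i * c (n - i)))\<^sup>2) \<le> (\<Sum>n\<le>N. (norm (c n))\<^sup>2)"
proof -
  define q where "q z = (\<Sum>n<Suc N. c n * z ^ n)" for z
  have q: "q holomorphic_on A" for A
    unfolding q_def by (intro holomorphic_intros)
  have "q has_fps_expansion (\<Sum>n<Suc N. fps_const (c n) * fps_X ^ n)"
    unfolding q_def by (intro has_fps_expansion_sum has_fps_expansion_cmult_left has_fps_expansion_fps_X_power)
  then have qc: "taylor_coeff q n = c n" if "n \<le> N" for n
    using that by (subst taylor_coeff_eqI) (auto simp: fps_sum_nth if_distrib cong: if_cong)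
  have Bq: "(\<lambda>z. B z * q z) holomorphic_on ball 0 \<rho>"
    by (intro holomorphic_intros B q)
  note cont = continuous_on_subset[OF holomorphic_on_imp_continuous_on, of _ "ball 0 \<rho>" "sphere 0 1"]
  have "(\<Sum>n\<le>N. (norm (\<Sum>i\<le>n. taylor_coeff B i * c (n - i)))\<^sup>2)
      = (\<Sum>n\<in>{..N}. (norm (taylor_coeff (\<lambda>z. B z * q z) n))\<^sup>2)"
    by (intro sum.cong refl) (subst taylor_coeff_mult[OF B(1) q], use B(2) in \<open>auto simp: qc\<close>)
  also have "\<dots> \<le> circle_mean (\<lambda>z. (norm (B z * q z))\<^sup>2)"
    using parseval_unit[OF Bq B(2)] sum_le_suminf[of "\<lambda>n. (norm (taylor_coeff (\<lambda>z. B z * q z) n))\<^sup>2" "{..N}"]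
    by (simp add: sums_iff)
  also have "\<dots> \<le> circle_mean (\<lambda>z. (norm (q z))\<^sup>2)"
  proof (rule circle_mean_mono)
    show "continuous_on (sphere 0 1) (\<lambda>z. (norm (B z * q z))\<^sup>2)" "continuous_on (sphere 0 1) (\<lambda>z. (norm (q z))\<^sup>2)"
      by (intro continuous_intros cont[OF Bq] cont[OF q]; use B(2) in auto)+
    show "(norm (B z * q z))\<^sup>2 \<le> (norm (q z))\<^sup>2" if "norm z = 1" for z
      using B(3)[OF that] by (auto simp: norm_mult intro!: power_mono mult_left_le_one_le)
  qed
  also have "\<dots> = (\<Sum>n\<le>N. (norm (c n))\<^sup>2)"
    unfolding q_def circle_mean_norm_square_poly by (simp only: lessThan_Suc_atMost)
  finally show ?thesis .
qed

lemma sum_mult_antimono_le: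
  fixes a c w :: "nat \<Rightarrow> real"
  assumes "\<And>n. n \<le> N \<Longrightarrow> (\<Sum>i\<le>n. a i) \<le> (\<Sum>i\<le>n. c i)" "antimono w" "\<And>n. 0 \<le> w n"
  shows "(\<Sum>n\<le>N. w n * a n) \<le> (\<Sum>n\<le>N. w n * c n)"
proof -
  have abel: "(\<Sum>n\<le>N. w n * a n) = w N * (\<Sum>i\<le>N. a i) + (\<Sum>n<N. (w n - w (Suc n)) * (\<Sum>i\<le>n. a i))" for a :: "nat \<Rightarrow> real" and N
    by (induction N) (auto simp: algebra_simps)
  show ?thesis
    unfolding abel
    using assms(1,3) antimonoD[OF assms(2), of _ "Suc _"]
    by (intro add_mono[OF mult_left_mono sum_mono[OF mult_left_mono]]) simp_all
qed

lemma multiplier_weighted: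
  assumes "B holomorphic_on ball 0 \<rho>" "1 < \<rho>" "\<And>z. norm z = 1 \<Longrightarrow> norm (B z) \<le> 1"
    and "antimono w" "\<And>n. 0 \<le> w n"
  shows "(\<Sum>n\<le>N. w n * (norm (\<Sum>i\<le>n. taylor_coeff B i * c (n - i)))\<^sup>2) \<le> (\<Sum>n\<le>N. w n * (norm (c n))\<^sup>2)"
  by (rule sum_mult_antimono_le[OF multiplier_partial_sums[OF assms(1-3)] assms(4,5)])

lemma multiplier_coeffs_le_1:
  assumes B: "B holomorphic_on ball 0 \<rho>" "1 < \<rho>" "\<And>z. norm z = 1 \<Longrightarrow> norm (B z) \<le> 1"
  shows "(\<Sum>n\<le>N. (norm (taylor_coeff B n))\<^sup>2) \<le> 1"
proof -
  have "(\<Sum>i\<le>n. taylor_coeff B i * (if n - i = 0 then 1 else 0)) = taylor_coeff B n" for n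
  proof -
    have "(\<Sum>i\<le>n. taylor_coeff B i * (if n - i = 0 then 1 else 0)) = (\<Sum>i\<le>n. if i = n then taylor_coeff B i else 0)"
      by (intro sum.cong) auto
    then show ?thesis by simp
  qed
  moreover have "(\<Sum>n\<le>N. (norm (if n = 0 then 1 else 0 :: complex))\<^sup>2) = 1"
    by (simp add: if_distrib if_distribR cong: if_cong)
  ultimately show ?thesis
    using multiplier_partial_sums[OF B, where N = N and c = "\<lambda>n. if n = 0 then 1 else 0"] by simp
qed

text \<open>The Schwarz-Pick bound at the origin, read off from the contraction property for polynomials
  \<open>1 + v z\<close> of degree one.\<close>

lemma multiplier_first_coeff:
  assumes B: "B holomorphic_on ball 0 \<rho>" "1 < \<rho>" "\<And>z. norm z = 1 \<Longrightarrow> norm (B z) \<le> 1"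
  shows "norm (taylor_coeff B 1) \<le> 1 - (norm (taylor_coeff B 0))\<^sup>2"
proof -
  define b where "b = norm (taylor_coeff B 0)"
  define d where "d = norm (taylor_coeff B 1)"
  have bd: "b\<^sup>2 + d\<^sup>2 \<le> 1"
    using multiplier_coeffs_le_1[OF B, of 1] by (simp add: b_def d_def)
  show ?thesis
  proof (cases "b = 1 \<or> b = 0 \<or> d = 0")
    case True
    have "d\<^sup>2 \<le> 1" "b\<^sup>2 \<le> 1" using bd by (smt (verit) zero_le_power2)+
    then have "d \<le> 1" by (simp add: power_le_one_iff d_def)
    then show ?thesis using True bd \<open>b\<^sup>2 \<le> 1\<close> by (auto simp: b_def d_def)
  next
    case False
    define s where "s = 1 - b\<^sup>2"
    have "b > 0" "d > 0" using False by (auto simp: b_def d_def)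
    then have s: "s > 0" using bd unfolding s_def by (smt (verit) zero_less_power)
    \<comment> \<open>this \<open>v\<close> maximises \<open>|b\<^sub>1 + b\<^sub>0 v|\<^sup>2 - |v|\<^sup>2\<close>: its phase aligns \<open>b\<^sub>0 v\<close> with \<open>b\<^sub>1\<close>\<close>
    define v where "v = of_real (b * d / s) * (taylor_coeff B 1 * b / (taylor_coeff B 0 * d))"
    have nv: "norm v = b * d / s"
      using \<open>b > 0\<close> \<open>d > 0\<close> s by (simp add: v_def norm_mult norm_divide b_def d_def abs_mult)
    have "taylor_coeff B 0 * v + taylor_coeff B 1 = of_real (1 + b\<^sup>2 / s) * taylor_coeff B 1"
      using \<open>b > 0\<close> \<open>d > 0\<close> s by (auto simp: v_def field_simps power2_eq_square b_def)
    then have n1: "norm (taylor_coeff B 0 * v + taylor_coeff B 1) = (1 + b\<^sup>2 / s) * d"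
      using s by (simp add: norm_mult d_def del: of_real_add)
    have "b\<^sup>2 + ((1 + b\<^sup>2 / s) * d)\<^sup>2 \<le> 1 + (b * d / s)\<^sup>2"
      using multiplier_partial_sums[OF B, where N = 1 and c = "\<lambda>n. if n = 0 then 1 else v"]
      unfolding b_def n1[unfolded b_def, symmetric] nv[unfolded b_def, symmetric] by (simp add: add.commute)
    moreover have "1 + b\<^sup>2 / s = 1 / s" using s by (simp add: s_def field_simps)
    ultimately have "(d / s)\<^sup>2 - (b * d / s)\<^sup>2 \<le> s" by (simp add: s_def)
    moreover have "(d / s)\<^sup>2 - (b * d / s)\<^sup>2 = d\<^sup>2 / s"
    proof -
      have "(d / s)\<^sup>2 - (b * d / s)\<^sup>2 = d\<^sup>2 * (1 - b\<^sup>2) / s\<^sup>2"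
        by (simp add: power_divide power_mult_distrib right_diff_distrib diff_divide_distrib mult.commute)
      also have "\<dots> = d\<^sup>2 / s"
        using s unfolding s_def[symmetric] by (simp add: power2_eq_square)
      finally show ?thesis .
    qed
    ultimately have "d\<^sup>2 / s \<le> s" by simp
    then have "d\<^sup>2 \<le> s\<^sup>2" using s by (simp add: pos_divide_le_eq power2_eq_square)
    then show ?thesis using s by (simp add: s_def b_def d_def power2_le_iff_abs_le)
  qed
qed

section \<open>Removing zeros by a finite Blaschke product\<close>

lemma holomorphic_divide_out_zero:
  assumes "f holomorphic_on S" "open S" "connected S" "a \<in> S" "f a = 0" "\<not> f constant_on S"
  obtains G n where "G holomorphic_on S" "\<And>z. z \<in> S \<Longrightarrow> f z = (z - a) ^ n * G z" "G a \<noteq> 0"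
proof -
  obtain g r n where g: "0 < n" "0 < r" "ball a r \<subseteq> S" "g holomorphic_on ball a r"
      "\<And>w. w \<in> ball a r \<Longrightarrow> f w = (w - a) ^ n * g w" "\<And>w. w \<in> ball a r \<Longrightarrow> g w \<noteq> 0"
    by (rule holomorphic_factor_zero_nonconstant[OF assms]) (rule that)
  define G where "G z = (if z = a then g a else f z / (z - a) ^ n)" for z
  have Gg: "G z = g z" if "z \<in> ball a r" for z
    using g(5)[OF that] by (auto simp: G_def)
  have "G holomorphic_on ball a r \<union> (S - {a})"
  proof (rule holomorphic_on_Un)
    show "G holomorphic_on ball a r"
      by (rule holomorphic_transform[OF g(4)]) (simp add: Gg)
    have "(\<lambda>z. f z / (z - a) ^ n) holomorphic_on S - {a}"
      by (intro holomorphic_intros holomorphic_on_subset[OF assms(1)]) auto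
    then show "G holomorphic_on S - {a}"
      by (rule holomorphic_transform) (simp add: G_def)
  qed (use assms in auto)
  moreover have "ball a r \<union> (S - {a}) = S" using g(2,3) assms(4) by auto
  ultimately have "G holomorphic_on S" by simp
  moreover have "f z = (z - a) ^ n * G z" if "z \<in> S" for z
    using assms(5) g(1) by (auto simp: G_def)
  moreover have "G a \<noteq> 0" using g by (simp add: G_def)
  ultimately show ?thesis by (rule that)
qed

lemma nonvanishing_on_larger_ball:
  assumes "g holomorphic_on ball 0 \<rho>" "1 < \<rho>" "\<And>z. norm z \<le> 1 \<Longrightarrow> g z \<noteq> 0"
  obtains \<sigma> where "1 < \<sigma>" "\<sigma> \<le> \<rho>" "\<And>z. norm z < \<sigma> \<Longrightarrow> g z \<noteq> 0"
proof -
  have "open {z \<in> ball 0 \<rho>. g z \<noteq> 0}"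
    using continuous_open_preimage[OF holomorphic_on_imp_continuous_on[OF assms(1)], of "- {0}"]
    by (simp add: Int_def vimage_def open_Compl)
  moreover have "cball 0 1 \<subseteq> {z \<in> ball 0 \<rho>. g z \<noteq> 0}"
    using assms by auto
  ultimately obtain e where e: "e > 0" "(\<Union>x\<in>cball 0 1. ball x e) \<subseteq> {z \<in> ball 0 \<rho>. g z \<noteq> 0}"
    using compact_subset_open_imp_ball_epsilon_subset[of "cball (0::complex) 1"] by (metis compact_cball)
  have "g z \<noteq> 0" if "norm z < min \<rho> (1 + e)" for z
  proof (cases "norm z \<le> 1")
    case False
    have "dist (sgn z) z = norm z - 1"
    proof -
      have "z - sgn z = (1 - 1 / norm z) *\<^sub>R z" by (simp add: sgn_div_norm algebra_simps divide_inverse)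
      then have "norm (z - sgn z) = \<bar>1 - 1 / norm z\<bar> * norm z" by (simp only: norm_scaleR)
      also have "\<dots> = norm z - 1" using False by (auto simp: field_simps abs_if)
      finally have "norm (z - sgn z) = norm z - 1" .
      then show ?thesis by (simp add: dist_norm norm_minus_commute)
    qed
    then have "z \<in> ball (sgn z) e" using that by auto
    moreover have "sgn z \<in> cball 0 1" using False by (auto simp: norm_sgn)
    ultimately show ?thesis using e by blast
  qed (use assms in auto)
  then show ?thesis using that[of "min \<rho> (1 + e)"] assms e by auto
qed

text \<open>The factors are taken on some disc of radius \<open>\<sigma> > 1\<close>, which may have to shrink with each zero \<open>a\<close>
  that is divided out: the Blaschke factor has its pole at the reflection of \<open>a\<close> in the circle, and
  zeros of \<open>F\<close> outside the closed disc have to be avoided.  The induction removes one zero, with its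
  full multiplicity, at a time.\<close>

lemma blaschke_factorization:
  assumes "F holomorphic_on ball 0 \<rho>" "1 < \<rho>" "\<And>z. norm z = 1 \<Longrightarrow> F z \<noteq> 0"
  obtains B g \<sigma> where "1 < \<sigma>" "\<sigma> \<le> \<rho>" "B holomorphic_on ball 0 \<sigma>" "g holomorphic_on ball 0 \<sigma>"
    "\<And>z. norm z < \<sigma> \<Longrightarrow> F z = B z * g z" "\<And>z. norm z = 1 \<Longrightarrow> norm (B z) = 1"
    "\<And>z. norm z < \<sigma> \<Longrightarrow> g z \<noteq> 0"
proof -
  have "\<exists>B g \<sigma>. 1 < \<sigma> \<and> \<sigma> \<le> \<rho> \<and> B holomorphic_on ball 0 \<sigma> \<and> g holomorphic_on ball 0 \<sigma> \<and>
    (\<forall>z. norm z < \<sigma> \<longrightarrow> F z = B z * g z) \<and> (\<forall>z. norm z = 1 \<longrightarrow> norm (B z) = 1) \<and>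
    (\<forall>z. norm z < \<sigma> \<longrightarrow> g z \<noteq> 0)"
    using assms
  proof (induction "card {z \<in> cball 0 1. F z = 0}" arbitrary: F \<rho> rule: less_induct)
    case less
    show ?case
    proof (cases "\<exists>a. norm a \<le> 1 \<and> F a = 0")
      case False
      then obtain \<sigma> where "1 < \<sigma>" "\<sigma> \<le> \<rho>" "\<And>z. norm z < \<sigma> \<Longrightarrow> F z \<noteq> 0"
        using nonvanishing_on_larger_ball[OF less.prems(1,2)] by metis
      then show ?thesis using less.prems(1)
        by (intro exI[of _ "\<lambda>_. 1"] exI[of _ F] exI[of _ \<sigma>]) (auto intro: holomorphic_on_subset)
    next
      case True
      then obtain a where a: "norm a \<le> 1" "F a = 0" by blast
      then have a1: "norm a < 1" using less.prems(3)[of a] by force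
      have nc: "\<not> F constant_on ball 0 \<rho>"
      proof
        assume "F constant_on ball 0 \<rho>"
        then have "F 1 = F a" using a1 less.prems(2) unfolding constant_on_def by auto
        then show False using less.prems(3)[of 1] a by auto
      qed
      obtain G n where G: "G holomorphic_on ball 0 \<rho>"
          "\<And>z. z \<in> ball 0 \<rho> \<Longrightarrow> F z = (z - a) ^ n * G z" "G a \<noteq> 0"
        using holomorphic_divide_out_zero[OF less.prems(1) _ _ _ a(2) nc] a1 less.prems(2) by auto
      have n: "n \<noteq> 0" using G(2)[of a] G(3) a a1 less.prems(2) by (intro notI) auto
      obtain s where s: "1 < s" "s * norm a < 1" "s \<le> \<rho>"
      proof (cases "a = 0")
        case True then show ?thesis using that[of \<rho>] less.prems(2) by auto
      next
        case False
        then have "1 < 1 / norm a" using a1 by simp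
        then obtain s where "1 < s" "s < min \<rho> (1 / norm a)" using dense[of 1 "min \<rho> (1 / norm a)"] less.prems(2) by auto
        then show ?thesis using that[of s] False by (auto simp: field_simps)
      qed
      have nz: "1 - cnj a * z \<noteq> 0" if "norm z < s" for z
      proof
        assume "1 - cnj a * z = 0"
        then have "norm a * norm z = 1" by (metis complex_mod_cnj eq_iff_diff_eq_0 norm_mult norm_one)
        moreover have "norm a * norm z \<le> norm a * s" using that by (intro mult_left_mono) auto
        ultimately show False using s by (simp add: mult.commute)
      qed
      \<comment> \<open>move the zero \<open>a\<close> to its reflection in the circle; this leaves \<open>|F|\<close> unchanged on the circle\<close>
      define F' where "F' z = (1 - cnj a * z) ^ n * G z" for z
      have F': "F' holomorphic_on ball 0 s"
        unfolding F'_def using s by (intro holomorphic_intros holomorphic_on_subset[OF G(1)]) auto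
      have zeros: "F' z = 0 \<longleftrightarrow> F z = 0 \<and> z \<noteq> a" if "norm z < s" for z
        using nz[OF that] G(2)[of z] G(3) that s n by (auto simp: F'_def)
      have fin: "finite {z \<in> cball 0 1. F z = 0}"
        by (rule holomorphic_compact_finite_zeros[OF less.prems(1) _ _ compact_cball _ nc]) (use less.prems(2) in auto)
      have "{z \<in> cball 0 1. F' z = 0} \<subset> {z \<in> cball 0 1. F z = 0}"
      proof (rule psubsetI)
        show "{z \<in> cball 0 1. F' z = 0} \<subseteq> {z \<in> cball 0 1. F z = 0}"
          using zeros s by auto
        have "a \<in> {z \<in> cball 0 1. F z = 0}" "a \<notin> {z \<in> cball 0 1. F' z = 0}"
          using zeros[of a] s a a1 by auto
        then show "{z \<in> cball 0 1. F' z = 0} \<noteq> {z \<in> cball 0 1. F z = 0}" by blast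
      qed
      then have "card {z \<in> cball 0 1. F' z = 0} < card {z \<in> cball 0 1. F z = 0}"
        by (intro psubset_card_mono fin)
      moreover have "F' z \<noteq> 0" if "norm z = 1" for z
        using zeros[of z] less.prems(3)[OF that] s that by auto
      ultimately have "\<exists>B g \<sigma>. 1 < \<sigma> \<and> \<sigma> \<le> s \<and> B holomorphic_on ball 0 \<sigma> \<and> g holomorphic_on ball 0 \<sigma> \<and>
          (\<forall>z. norm z < \<sigma> \<longrightarrow> F' z = B z * g z) \<and> (\<forall>z. norm z = 1 \<longrightarrow> norm (B z) = 1) \<and>
          (\<forall>z. norm z < \<sigma> \<longrightarrow> g z \<noteq> 0)"
        by (intro less.hyps F' s(1))
      then obtain B g \<sigma> where IH: "1 < \<sigma>" "\<sigma> \<le> s" "B holomorphic_on ball 0 \<sigma>" "g holomorphic_on ball 0 \<sigma>"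
        "\<And>z. norm z < \<sigma> \<Longrightarrow> F' z = B z * g z" "\<And>z. norm z = 1 \<Longrightarrow> norm (B z) = 1"
        "\<And>z. norm z < \<sigma> \<Longrightarrow> g z \<noteq> 0"
        by blast
      have "norm (z - a) = norm (1 - cnj a * z)" if "norm z = 1" for z
      proof -
        have "norm (z - a) = norm (cnj z) * norm (z - a)" using that by simp
        also have "\<dots> = norm (cnj z * (z - a))" by (rule norm_mult[symmetric])
        also have "cnj z * (z - a) = cnj (1 - cnj a * z)"
          using that complex_norm_square[of z] by (simp add: algebra_simps)
        finally show ?thesis by (metis complex_mod_cnj)
      qed
      then have "norm (((z - a) / (1 - cnj a * z)) ^ n * B z) = 1" if "norm z = 1" for z
        using that IH(6)[OF that] nz[of z] s by (simp add: norm_mult norm_power norm_divide)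
      moreover have "(\<lambda>z. ((z - a) / (1 - cnj a * z)) ^ n * B z) holomorphic_on ball 0 \<sigma>"
        using nz IH(2) by (intro holomorphic_intros IH) auto
      moreover have "F z = ((z - a) / (1 - cnj a * z)) ^ n * B z * g z" if "norm z < \<sigma>" for z
      proof -
        have "((z - a) / (1 - cnj a * z)) ^ n * B z * g z
            = (z - a) ^ n / (1 - cnj a * z) ^ n * ((1 - cnj a * z) ^ n * G z)"
          using IH(5)[OF that] by (simp only: F'_def power_divide mult.assoc)
        also have "\<dots> = (z - a) ^ n * G z"
          using nz[of z] IH(2) that by simp
        also have "\<dots> = F z"
          using G(2)[of z] IH(2) s that by simp
        finally show ?thesis ..
      qed
      ultimately show ?thesis
        using IH(1,2,4,7) s(3)
        by (intro exI[of _ "\<lambda>z. ((z - a) / (1 - cnj a * z)) ^ n * B z"] exI[of _ g] exI[of _ \<sigma>] conjI allI impI)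
          (assumption | simp)+
    qed
  qed
  then obtain B g \<sigma> where "1 < \<sigma>" "\<sigma> \<le> \<rho>" "B holomorphic_on ball 0 \<sigma>" "g holomorphic_on ball 0 \<sigma>"
    "\<forall>z. norm z < \<sigma> \<longrightarrow> F z = B z * g z" "\<forall>z. norm z = 1 \<longrightarrow> norm (B z) = 1"
    "\<forall>z. norm z < \<sigma> \<longrightarrow> g z \<noteq> 0"
    by (elim exE conjE)
  then show ?thesis by (intro that[of \<sigma> B g]) simp_all
qed

section \<open>Weighted coefficient bounds for powers of a zero-free function\<close>

lemma norm_exp_of_real_mult: "norm (exp (of_real a * w)) = norm (exp w) powr a" for w :: complex
  by (simp add: powr_def mult.commute)

text \<open>Cauchy-Schwarz against the geometric series: point evaluation on \<open>H\<^sup>2\<close>.\<close>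

lemma norm_square_le_mean:
  assumes h: "h holomorphic_on ball 0 \<rho>" "1 < \<rho>" and z: "norm z < 1"
  shows "(norm (h z))\<^sup>2 \<le> circle_mean (\<lambda>z. (norm (h z))\<^sup>2) / (1 - (norm z)\<^sup>2)"
proof -
  define a where "a = taylor_coeff h"
  have z2: "(norm z)\<^sup>2 < 1" using z by (simp add: power_less_one_iff)
  have "(\<lambda>N. \<Sum>n<N. a n * z ^ n) \<longlonglongrightarrow> h z"
    using taylor_coeff_sums[OF h(1), of z] z h(2) by (simp add: sums_def a_def)
  then have "(\<lambda>N. (norm (\<Sum>n<N. a n * z ^ n))\<^sup>2) \<longlonglongrightarrow> (norm (h z))\<^sup>2"
    by (intro tendsto_intros)
  then show ?thesis
  proof (rule LIMSEQ_le_const2, intro exI allI impI)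
    fix N
    have "(norm (\<Sum>n<N. a n * z ^ n))\<^sup>2 \<le> (\<Sum>n<N. norm (a n) * norm z ^ n)\<^sup>2"
      by (intro power_mono order.trans[OF norm_sum]) (auto simp: norm_mult norm_power)
    also have "\<dots> \<le> (\<Sum>n<N. (norm (a n))\<^sup>2) * (\<Sum>n<N. (norm z ^ n)\<^sup>2)"
      by (rule Cauchy_Schwarz_ineq_sum)
    also have "\<dots> \<le> circle_mean (\<lambda>z. (norm (h z))\<^sup>2) * (1 / (1 - (norm z)\<^sup>2))"
    proof (intro mult_mono)
      show "(\<Sum>n<N. (norm (a n))\<^sup>2) \<le> circle_mean (\<lambda>z. (norm (h z))\<^sup>2)"
        using parseval_unit[OF h] sum_le_suminf[of "\<lambda>n. (norm (a n))\<^sup>2" "{..<N}"]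
        by (simp add: sums_iff a_def)
      have "(\<lambda>n. ((norm z)\<^sup>2) ^ n) sums (1 / (1 - (norm z)\<^sup>2))"
        using z2 by (intro geometric_sums) auto
      then have "(\<Sum>n<N. ((norm z)\<^sup>2) ^ n) \<le> 1 / (1 - (norm z)\<^sup>2)"
        using sum_le_suminf[of "\<lambda>n. ((norm z)\<^sup>2) ^ n" "{..<N}"] by (simp add: sums_iff)
      then show "(\<Sum>n<N. (norm z ^ n)\<^sup>2) \<le> 1 / (1 - (norm z)\<^sup>2)"
        by (simp add: power_mult[symmetric] mult.commute)
    qed (auto intro!: circle_mean_nonneg sum_nonneg)
    finally show "(norm (\<Sum>n<N. a n * z ^ n))\<^sup>2 \<le> circle_mean (\<lambda>z. (norm (h z))\<^sup>2) / (1 - (norm z)\<^sup>2)"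
      by simp
  qed
qed

lemma has_integral_power_01: "((\<lambda>x::real. x ^ n) has_integral 1 / real (Suc n)) {0..1}"
proof -
  have "((\<lambda>x::real. x ^ n) has_integral (1 ^ Suc n / real (Suc n) - 0 ^ Suc n / real (Suc n))) {0..1}"
  proof (rule fundamental_theorem_of_calculus)
    show "((\<lambda>x. x ^ Suc n / real (Suc n)) has_vector_derivative x ^ n) (at x within {0..1})" for x :: real
      using DERIV_cdivide[OF DERIV_pow[of "Suc n" x], of "real (Suc n)"]
      by (simp add: has_vector_derivative_at_within del: of_nat_Suc flip: has_real_derivative_iff_has_vector_derivative)
  qed auto
  then show ?thesis by simp
qed

lemma beta_integrand_integrable:
  assumes "\<gamma> > 0"
  shows "(\<lambda>x::real. x ^ n * (1 - x) powr \<gamma>) integrable_on {0..1}"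
  using assms by (intro integrable_continuous_real continuous_intros continuous_on_powr') auto

text \<open>The integral is the Beta value at \<open>(n + 1, \<gamma> + 1)\<close>.  Its order of magnitude is already reached on
  the interval from \<open>n / (n + 1)\<close> to \<open>1\<close>, where \<open>x\<^sup>n\<close> is at least \<open>1 / e\<close>.\<close>

lemma beta_integral_ge:
  assumes "\<gamma> > 0"
  shows "exp (-1) / (\<gamma> + 1) * real (n + 1) powr (-(\<gamma> + 1)) \<le> integral {0..1} (\<lambda>x::real. x ^ n * (1 - x) powr \<gamma>)"
proof -
  define \<delta> where "\<delta> = real n / real (n + 1)"
  have \<delta>: "0 \<le> \<delta>" "\<delta> < 1" "1 - \<delta> = 1 / real (n + 1)" by (auto simp: \<delta>_def field_simps)
  have pow: "exp (-1) \<le> x ^ n" if "x \<ge> \<delta>" for x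
  proof (cases "n = 0")
    case False
    have "inverse \<delta> \<le> exp (1 / real n)"
      using exp_ge_add_one_self[of "1 / real n"] False by (simp add: \<delta>_def field_simps)
    then have "inverse \<delta> ^ n \<le> exp (1 / real n) ^ n"
      using \<delta> by (intro power_mono) auto
    also have "\<dots> = exp 1" using False by (simp flip: exp_of_nat_mult)
    finally have "inverse (exp 1) \<le> inverse (inverse \<delta> ^ n)"
      using False by (intro le_imp_inverse_le) (auto simp: \<delta>_def)
    then have "exp (-1) \<le> \<delta> ^ n" by (simp add: power_inverse exp_minus)
    also have "\<dots> \<le> x ^ n" using that \<delta> by (intro power_mono) auto
    finally show ?thesis .
  qed auto
  have int: "((\<lambda>x. (1 - x) powr \<gamma>) has_integral
      (- ((1 - 1) powr (\<gamma> + 1) / (\<gamma> + 1)) - (- ((1 - \<delta>) powr (\<gamma> + 1) / (\<gamma> + 1))))) {\<delta>..1}"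
  proof (rule fundamental_theorem_of_calculus_interior)
    show "continuous_on {\<delta>..1} (\<lambda>x. - ((1 - x) powr (\<gamma> + 1) / (\<gamma> + 1)))"
      using assms by (intro continuous_intros continuous_on_powr') auto
    fix x assume "x \<in> {\<delta><..<1}"
    then have "((\<lambda>x. (1 - x) powr (\<gamma> + 1)) has_real_derivative - ((\<gamma> + 1) * (1 - x) powr \<gamma>)) (at x)"
      by (auto intro!: derivative_eq_intros)
    from DERIV_minus[OF DERIV_cdivide[OF this, of "\<gamma> + 1"]]
    show "((\<lambda>x. - ((1 - x) powr (\<gamma> + 1) / (\<gamma> + 1))) has_vector_derivative (1 - x) powr \<gamma>) (at x)"
      using assms by (simp flip: has_real_derivative_iff_has_vector_derivative)
  qed (use \<delta> in auto)
  have "exp (-1) / (\<gamma> + 1) * real (n + 1) powr (-(\<gamma> + 1)) = exp (-1) * ((1 - \<delta>) powr (\<gamma> + 1) / (\<gamma> + 1))"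
  proof -
    have "real (n + 1) powr (-(\<gamma> + 1)) = (1 / real (n + 1)) powr (\<gamma> + 1)"
      by (simp only: powr_minus_divide powr_divide powr_one_eq_one)
    then show ?thesis unfolding \<delta>(3) by simp
  qed
  also have "\<dots> = integral {\<delta>..1} (\<lambda>x. exp (-1) * (1 - x) powr \<gamma>)"
    using int assms by (simp add: integral_unique)
  also have "\<dots> \<le> integral {\<delta>..1} (\<lambda>x. x ^ n * (1 - x) powr \<gamma>)"
  proof (intro integral_le)
    show "(\<lambda>x. exp (-1) * (1 - x) powr \<gamma>) integrable_on {\<delta>..1}"
      using int by (auto intro!: integrable_on_mult_right)
    show "(\<lambda>x. x ^ n * (1 - x) powr \<gamma>) integrable_on {\<delta>..1}"
      using beta_integrand_integrable[OF assms] by (rule integrable_on_subinterval) (use \<delta> in auto)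
    show "exp (-1) * (1 - x) powr \<gamma> \<le> x ^ n * (1 - x) powr \<gamma>" if "x \<in> {\<delta>..1}" for x
      using pow[of x] that by (intro mult_right_mono) auto
  qed
  also have "\<dots> \<le> integral {0..1} (\<lambda>x. x ^ n * (1 - x) powr \<gamma>)"
    using beta_integrand_integrable[OF assms] \<delta>
    by (intro integral_subset_le integrable_on_subinterval[OF beta_integrand_integrable[OF assms]]) auto
  finally show ?thesis .
qed

text \<open>Parseval on the circle of radius \<open>\<surd>x\<close> and the pointwise bound for \<open>exp l\<close> compare the power series
  in \<open>x\<close> of the squared coefficients of the product and of \<open>k\<close>, at the price of a factor
  \<open>(S / (1 - x))\<^sup>\<beta>\<close>.  Multiplying by \<open>(1 - x) powr (\<beta> + 1)\<close> and integrating over \<open>x\<close> from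
  \<open>0\<close> to \<open>1\<close> turns the powers of \<open>x\<close> into the weights.\<close>

lemma exp_multiplier_weighted:
  fixes \<beta> :: real
  assumes l: "l holomorphic_on ball 0 \<rho>" and k: "k holomorphic_on ball 0 \<rho>"
    and \<rho>: "1 < \<rho>" and \<beta>: "0 \<le> \<beta>"
  defines "S \<equiv> circle_mean (\<lambda>z. (norm (exp (l z)))\<^sup>2)"
  shows "(\<Sum>n\<le>N. (norm (taylor_coeff (\<lambda>z. exp (of_real \<beta> * l z) * k z) n))\<^sup>2 * real (n + 1) powr (-(\<beta> + 2)))
     \<le> (\<beta> + 2) * exp 1 * S powr \<beta> * (\<Sum>n. (norm (taylor_coeff k n))\<^sup>2 / (real (n + 1) * real (n + 2)))"
proof -
  define q where "q z = exp (of_real \<beta> * l z) * k z" for z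
  define Q where "Q n = (norm (taylor_coeff q n))\<^sup>2" for n
  define K where "K n = (norm (taylor_coeff k n))\<^sup>2" for n
  have q: "q holomorphic_on ball 0 \<rho>" unfolding q_def by (intro holomorphic_intros l k)
  have h: "(\<lambda>z. exp (l z)) holomorphic_on ball 0 \<rho>" by (intro holomorphic_intros l)
  have Q0: "Q n \<ge> 0" and K0: "K n \<ge> 0" for n by (auto simp: Q_def K_def)
  have S0: "S \<ge> 0" unfolding S_def by (intro circle_mean_nonneg) auto
  have sK: "summable K" using parseval_unit[OF k \<rho>] by (simp add: sums_iff K_def[abs_def])
  have sKx: "summable (\<lambda>n. K n * x ^ n)" if "0 \<le> x" "x \<le> 1" for x
    using K0 that by (intro summable_comparison_test'[OF sK, of 0]) (auto simp: abs_mult power_le_one mult_left_le)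
  have mean: "(\<Sum>n\<le>N. Q n * x ^ n) \<le> (S / (1 - x)) powr \<beta> * (\<Sum>n. K n * x ^ n)" if x: "0 \<le> x" "x < 1" for x
  proof -
    define r where "r = sqrt x"
    have r: "0 \<le> r" "r < 1" "r\<^sup>2 = x" using x by (auto simp: r_def)
    then have r\<rho>: "r < \<rho>" using \<rho> by simp
    note r = r(1,2) r\<rho> r(3)
    have "(\<Sum>n\<le>N. Q n * x ^ n) \<le> circle_mean (\<lambda>z. (norm (q (of_real r * z)))\<^sup>2)"
      using parseval[OF q r(1,3)] sum_le_suminf[of "\<lambda>n. Q n * x ^ n" "{..N}"] x Q0
      by (simp add: sums_iff r(4) Q_def)
    also have "\<dots> \<le> circle_mean (\<lambda>z. (S / (1 - x)) powr \<beta> * (norm (k (of_real r * z)))\<^sup>2)"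
    proof (rule circle_mean_mono)
      show "continuous_on (sphere 0 1) (\<lambda>z. (norm (q (of_real r * z)))\<^sup>2)"
        "continuous_on (sphere 0 1) (\<lambda>z. (S / (1 - x)) powr \<beta> * (norm (k (of_real r * z)))\<^sup>2)"
        by (intro continuous_intros continuous_on_circle_dilate[OF q r(1,3)] continuous_on_circle_dilate[OF k r(1,3)])+
      fix z :: complex assume z: "norm z = 1"
      have nz: "norm (of_real r * z) = r" using z r by (simp add: norm_mult)
      have "(norm (exp (of_real \<beta> * l (of_real r * z))))\<^sup>2 = ((norm (exp (l (of_real r * z))))\<^sup>2) powr \<beta>"
        unfolding norm_exp_of_real_mult by (simp add: powr_power powr_powr mult.commute flip: powr_numeral)
      also have "\<dots> \<le> (S / (1 - x)) powr \<beta>"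
        using norm_square_le_mean[OF h \<rho>, of "of_real r * z"] r \<beta> unfolding S_def nz
        by (intro powr_mono2) auto
      finally show "(norm (q (of_real r * z)))\<^sup>2 \<le> (S / (1 - x)) powr \<beta> * (norm (k (of_real r * z)))\<^sup>2"
        unfolding q_def norm_mult power_mult_distrib by (intro mult_right_mono) auto
    qed
    also have "\<dots> = (S / (1 - x)) powr \<beta> * (\<Sum>n. K n * x ^ n)"
      unfolding circle_mean_cmult using parseval[OF k r(1,3)] by (simp add: sums_iff r(4) K_def)
    finally show ?thesis .
  qed
  \<comment> \<open>cutting the series of \<open>k\<close> at \<open>M\<close> keeps the integrands polynomial on the right; the remainder
    vanishes as \<open>M\<close> grows\<close>
  have bound: "(\<Sum>n\<le>N. Q n * (x ^ n * (1 - x) powr (\<beta> + 1)))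
      \<le> S powr \<beta> * ((\<Sum>n<M. K n * (x ^ n - x ^ Suc n)) + (\<Sum>n. K (n + M)))" if x: "0 \<le> x" "x \<le> 1" for x M
  proof (cases "x = 1")
    case True
    then show ?thesis using K0 sK \<beta> by (auto intro!: mult_nonneg_nonneg suminf_nonneg summable_ignore_initial_segment)
  next
    case False
    with x have x1: "x < 1" by simp
    have "(\<Sum>n\<le>N. Q n * (x ^ n * (1 - x) powr (\<beta> + 1))) = (1 - x) powr (\<beta> + 1) * (\<Sum>n\<le>N. Q n * x ^ n)"
      by (simp add: sum_distrib_left mult_ac)
    also have "\<dots> \<le> (1 - x) powr (\<beta> + 1) * ((S / (1 - x)) powr \<beta> * (\<Sum>n. K n * x ^ n))"
      using mean[OF x(1) x1] by (intro mult_left_mono) auto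
    also have "\<dots> = S powr \<beta> * ((1 - x) * (\<Sum>n. K n * x ^ n))"
      using x1 S0 by (simp add: powr_add powr_divide)
    also have "(1 - x) * (\<Sum>n. K n * x ^ n) = (\<Sum>n<M. K n * (x ^ n - x ^ Suc n)) + (1 - x) * (\<Sum>n. K (n + M) * x ^ (n + M))"
      by (subst suminf_split_initial_segment[OF sKx[OF x], of M]) (simp add: algebra_simps sum_distrib_left sum_subtractf)
    also have "(1 - x) * (\<Sum>n. K (n + M) * x ^ (n + M)) \<le> 1 * (\<Sum>n. K (n + M))"
      using x x1 K0 sK sKx[OF x]
      by (intro mult_mono suminf_le suminf_nonneg mult_nonneg_nonneg)
         (auto simp: power_le_one mult_left_le intro!: summable_ignore_initial_segment[of K] summable_ignore_initial_segment[of "\<lambda>n. K n * x ^ n"])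
    finally show ?thesis by (simp add: mult_left_mono)
  qed
  have ineq: "(\<Sum>n\<le>N. Q n * integral {0..1} (\<lambda>x. x ^ n * (1 - x) powr (\<beta> + 1)))
      \<le> S powr \<beta> * ((\<Sum>n<M. K n / (real (n + 1) * real (n + 2))) + (\<Sum>n. K (n + M)))" for M
  proof (rule has_integral_le)
    show "((\<lambda>x. \<Sum>n\<le>N. Q n * (x ^ n * (1 - x) powr (\<beta> + 1))) has_integral
        (\<Sum>n\<le>N. Q n * integral {0..1} (\<lambda>x. x ^ n * (1 - x) powr (\<beta> + 1)))) {0..1}"
      using beta_integrand_integrable[of "\<beta> + 1"] \<beta>
      by (intro has_integral_sum has_integral_mult_right) (auto simp: has_integral_integral)
    have "((\<lambda>x::real. x ^ n - x ^ Suc n) has_integral 1 / (real (n + 1) * real (n + 2))) {0..1}" for n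
      using has_integral_diff[OF has_integral_power_01[of n] has_integral_power_01[of "Suc n"]]
      by (simp add: field_simps)
    then have "((\<lambda>x. S powr \<beta> * ((\<Sum>n<M. K n * (x ^ n - x ^ Suc n)) + (\<Sum>n. K (n + M)))) has_integral
       S powr \<beta> * ((\<Sum>n<M. K n * (1 / (real (n + 1) * real (n + 2)))) + (\<Sum>n. K (n + M)))) {0..1}"
      using has_integral_const_real[of "\<Sum>n. K (n + M)" 0 1]
      by (intro has_integral_mult_right has_integral_add has_integral_sum) auto
    then show "((\<lambda>x. S powr \<beta> * ((\<Sum>n<M. K n * (x ^ n - x ^ Suc n)) + (\<Sum>n. K (n + M)))) has_integral
       S powr \<beta> * ((\<Sum>n<M. K n / (real (n + 1) * real (n + 2))) + (\<Sum>n. K (n + M)))) {0..1}"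
      by simp
  qed (use bound in auto)
  have sK2: "summable (\<lambda>n. K n / (real (n + 1) * real (n + 2)))"
  proof (rule summable_comparison_test'[OF sK, of 0])
    fix n :: nat
    have "1 \<le> real (n + 1) * real (n + 2)" by (simp add: algebra_simps)
    then show "norm (K n / (real (n + 1) * real (n + 2))) \<le> K n"
      using K0[of n] by (simp add: abs_mult divide_le_eq mult_left_le mult_le_cancel_left1)
  qed
  have "(\<lambda>M. S powr \<beta> * ((\<Sum>n<M. K n / (real (n + 1) * real (n + 2))) + (\<Sum>n. K (n + M))))
     \<longlonglongrightarrow> S powr \<beta> * ((\<Sum>n. K n / (real (n + 1) * real (n + 2))) + 0)"
    by (intro tendsto_intros summable_LIMSEQ[OF sK2] suminf_exist_split2[OF sK])
  from LIMSEQ_le_const[OF this] ineq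
  have *: "(\<Sum>n\<le>N. Q n * integral {0..1} (\<lambda>x. x ^ n * (1 - x) powr (\<beta> + 1)))
      \<le> S powr \<beta> * (\<Sum>n. K n / (real (n + 1) * real (n + 2)))" by auto
  have c: "(\<beta> + 2) * exp 1 * (exp (-1) / (\<beta> + 2)) = 1"
  proof -
    have "\<beta> + 2 \<noteq> 0" using \<beta> by simp
    then show ?thesis by (simp add: exp_minus)
  qed
  have "(\<Sum>n\<le>N. Q n * real (n + 1) powr (-(\<beta> + 2)))
      = (\<beta> + 2) * exp 1 * (\<Sum>n\<le>N. Q n * (exp (-1) / (\<beta> + 2) * real (n + 1) powr (-(\<beta> + 2))))"
  proof -
    have "q' * w = (\<beta> + 2) * exp 1 * (q' * (exp (-1) / (\<beta> + 2) * w))" for q' w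
    proof -
      have "(\<beta> + 2) * exp 1 * (q' * (exp (-1) / (\<beta> + 2) * w)) = ((\<beta> + 2) * exp 1 * (exp (-1) / (\<beta> + 2))) * (q' * w)"
        by (simp only: mult_ac)
      then show ?thesis unfolding c by simp
    qed
    then show ?thesis unfolding sum_distrib_left by (intro sum.cong refl)
  qed
  also have "\<dots> \<le> (\<beta> + 2) * exp 1 * (\<Sum>n\<le>N. Q n * integral {0..1} (\<lambda>x. x ^ n * (1 - x) powr (\<beta> + 1)))"
    using beta_integral_ge[of "\<beta> + 1"] \<beta> Q0
    by (intro mult_left_mono sum_mono) (auto simp: algebra_simps)
  also have "\<dots> \<le> (\<beta> + 2) * exp 1 * (S powr \<beta> * (\<Sum>n. K n / (real (n + 1) * real (n + 2))))"
    using \<beta> by (intro mult_left_mono *) auto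
  finally show ?thesis
    unfolding Q_def K_def q_def by (simp add: mult_ac)
qed


text \<open>Bernoulli's inequality for exponents between \<open>0\<close> and \<open>1\<close>, as convexity of \<open>exp\<close> between \<open>0\<close> and
  \<open>ln t\<close>.\<close>

lemma powr_le_affine:
  fixes t \<beta> :: real
  assumes "0 < t" "0 \<le> \<beta>" "\<beta> \<le> 1"
  shows "t powr \<beta> \<le> 1 + \<beta> * (t - 1)"
  using convex_onD[OF exp_convex, of \<beta> 0 "ln t"] assms
  by (simp add: powr_def algebra_simps)

text \<open>Jensen's inequality: integrate the tangent to \<open>x\<^sup>\<beta>\<close> at the mean value.\<close>

lemma mean_powr_le:
  assumes u: "continuous_on (sphere 0 1) u" "\<And>z. norm z = 1 \<Longrightarrow> u z > 0" and \<beta>: "0 \<le> \<beta>" "\<beta> \<le> 1"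
    and S: "circle_mean u > 0"
  shows "circle_mean (\<lambda>z. u z powr \<beta>) \<le> circle_mean u powr \<beta>"
proof -
  define S where "S = circle_mean u"
  have "circle_mean (\<lambda>z. u z powr \<beta>) \<le> circle_mean (\<lambda>z. S powr \<beta> * (1 - \<beta>) + S powr \<beta> * \<beta> / S * u z)"
  proof (rule circle_mean_mono)
    show "continuous_on (sphere 0 1) (\<lambda>z. u z powr \<beta>)"
      using u by (intro continuous_on_powr continuous_intros) (auto simp: less_imp_neq[symmetric])
    show "continuous_on (sphere 0 1) (\<lambda>z. S powr \<beta> * (1 - \<beta>) + S powr \<beta> * \<beta> / S * u z)"
      by (intro continuous_intros u)
    fix z :: complex assume "norm z = 1"
    then have uz: "u z > 0" by (rule u)
    have "(u z / S) powr \<beta> \<le> 1 + \<beta> * (u z / S - 1)"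
      using uz S \<beta> by (intro powr_le_affine) (auto simp: S_def)
    then have "S powr \<beta> * (u z / S) powr \<beta> \<le> S powr \<beta> * (1 + \<beta> * (u z / S - 1))"
      by (intro mult_left_mono) auto
    moreover have "S powr \<beta> * (u z / S) powr \<beta> = u z powr \<beta>"
      using uz S by (simp add: S_def powr_divide)
    ultimately show "u z powr \<beta> \<le> S powr \<beta> * (1 - \<beta>) + S powr \<beta> * \<beta> / S * u z"
      by (simp add: algebra_simps)
  qed
  also have "\<dots> = S powr \<beta>"
    using S by (subst circle_mean_affine[OF u(1)]) (simp add: S_def algebra_simps)
  finally show ?thesis by (simp add: S_def)
qed

lemma mean_norm_square_split:
  assumes h: "h holomorphic_on ball 0 \<rho>" "1 < \<rho>"
  shows "(\<lambda>n. (norm (taylor_coeff h (n + M)))\<^sup>2) sums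
           (circle_mean (\<lambda>z. (norm (h z))\<^sup>2) - (\<Sum>n<M. (norm (taylor_coeff h n))\<^sup>2))"
  using sums_split_initial_segment[OF parseval_unit[OF h]] .

lemma deriv_exp_real_mult:
  assumes "l holomorphic_on ball 0 \<rho>" "norm z < \<rho>"
  shows "deriv (\<lambda>z. exp (of_real a * l z)) z = of_real a * deriv l z * exp (of_real a * l z)"
proof -
  have "(l has_field_derivative deriv l z) (at z)"
    using holomorphic_derivI[OF assms(1)] assms(2) by auto
  then show ?thesis
    by (intro DERIV_imp_deriv) (auto intro!: derivative_eq_intros)
qed

lemma deriv_exp_powr_factor:
  assumes "l holomorphic_on ball 0 \<rho>" "norm z < \<rho>"
  shows "deriv (\<lambda>z. exp (of_real a * l z)) z
       = of_real a * (exp (of_real (a - 1) * l z) * deriv (\<lambda>z. exp (l z)) z)"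
  using deriv_exp_real_mult[OF assms, of a] deriv_exp_real_mult[OF assms, of 1]
  by (simp add: algebra_simps flip: exp_add)

text \<open>The coefficients of positive index of \<open>h\<^sup>\<beta>\<close>, for \<open>h = exp l\<close>, are those of \<open>h\<^sup>\<beta> - 1\<close>.  For
  \<open>\<beta> \<le> 1\<close> Jensen's inequality bounds even their unweighted sum of squares by \<open>S\<^sup>\<beta> - 1\<close>.  For larger
  \<open>\<beta>\<close> the exponent \<open>\<beta> - 1\<close> in the derivative \<open>\<beta> h\<^sup>\<beta> h' / h\<close> is nonnegative, so that
  \<open>exp_multiplier_weighted\<close> applies to it.\<close>

lemma exp_power_minus_one_weighted:
  fixes \<beta> :: real
  assumes l: "l holomorphic_on ball 0 \<rho>" and \<rho>: "1 < \<rho>" and l0: "l 0 = 0" and \<beta>: "0 < \<beta>"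
  defines "S \<equiv> circle_mean (\<lambda>z. (norm (exp (l z)))\<^sup>2)"
  shows "(\<Sum>n<N. (norm (taylor_coeff (\<lambda>z. exp (of_real \<beta> * l z)) (Suc n)))\<^sup>2 * real (n + 2) powr (-(\<beta> + 2)))
     \<le> (1 + (\<beta> + 1) * exp 1 * \<beta>\<^sup>2) * (S powr (\<beta> - 1) * (S - 1))"
proof -
  define h where "h z = exp (l z)" for z
  define \<kappa> where "\<kappa> z = exp (of_real \<beta> * l z)" for z
  have h: "h holomorphic_on ball 0 \<rho>" and \<kappa>: "\<kappa> holomorphic_on ball 0 \<rho>"
    unfolding h_def \<kappa>_def by (intro holomorphic_intros l)+
  have tail: "(\<lambda>n. (norm (taylor_coeff h (Suc n)))\<^sup>2) sums (S - 1)"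
    using mean_norm_square_split[OF h \<rho>, of 1] by (simp add: S_def taylor_coeff_0 h_def l0)
  have S1: "S \<ge> 1"
    using sums_le[OF _ sums_zero tail] by simp
  have "(\<Sum>n<N. (norm (taylor_coeff \<kappa> (Suc n)))\<^sup>2 * real (n + 2) powr (-(\<beta> + 2)))
     \<le> max 1 ((\<beta> + 1) * exp 1 * \<beta>\<^sup>2) * (S powr (\<beta> - 1) * (S - 1))"
  proof (cases "\<beta> \<le> 1")
    case True
    have "(\<lambda>n. (norm (taylor_coeff \<kappa> (Suc n)))\<^sup>2) sums (circle_mean (\<lambda>z. (norm (\<kappa> z))\<^sup>2) - 1)"
      using mean_norm_square_split[OF \<kappa> \<rho>, of 1] by (simp add: taylor_coeff_0 \<kappa>_def l0)
    then have "(\<Sum>n<N. (norm (taylor_coeff \<kappa> (Suc n)))\<^sup>2) \<le> circle_mean (\<lambda>z. (norm (\<kappa> z))\<^sup>2) - 1"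
      using sum_le_suminf[of "\<lambda>n. (norm (taylor_coeff \<kappa> (Suc n)))\<^sup>2" "{..<N}"] by (simp add: sums_iff)
    moreover have "(\<Sum>n<N. (norm (taylor_coeff \<kappa> (Suc n)))\<^sup>2 * real (n + 2) powr (-(\<beta> + 2))) \<le> (\<Sum>n<N. (norm (taylor_coeff \<kappa> (Suc n)))\<^sup>2)"
    proof (intro sum_mono mult_left_le)
      show "real (n + 2) powr (-(\<beta> + 2)) \<le> 1" for n
        using powr_mono[of "-(\<beta> + 2)" 0 "real (n + 2)"] \<beta> by simp
    qed auto
    moreover have "circle_mean (\<lambda>z. (norm (\<kappa> z))\<^sup>2) \<le> S powr \<beta>"
    proof -
      have "(norm (\<kappa> z))\<^sup>2 = ((norm (exp (l z)))\<^sup>2) powr \<beta>" for z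
        unfolding \<kappa>_def norm_exp_of_real_mult by (simp add: powr_power powr_powr mult.commute flip: powr_numeral)
      moreover have "circle_mean (\<lambda>z. ((norm (exp (l z)))\<^sup>2) powr \<beta>) \<le> S powr \<beta>"
        unfolding S_def
      proof (rule mean_powr_le)
        show "continuous_on (sphere 0 1) (\<lambda>z. (norm (exp (l z)))\<^sup>2)"
          using \<rho> by (intro continuous_intros continuous_on_subset[OF holomorphic_on_imp_continuous_on[OF l]]) auto
      qed (use True \<beta> S1 in \<open>auto simp: S_def\<close>)
      ultimately show ?thesis by simp
    qed
    moreover have "S powr \<beta> - 1 \<le> S powr (\<beta> - 1) * (S - 1)"
    proof -
      have "S powr (\<beta> - 1) \<le> 1" using powr_mono[of "\<beta> - 1" 0 S] S1 True by simp
      moreover have "S powr \<beta> = S powr (\<beta> - 1) * S"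
        using S1 by (simp add: powr_diff)
      ultimately show ?thesis by (simp add: algebra_simps)
    qed
    moreover have "1 * (S powr (\<beta> - 1) * (S - 1)) \<le> max 1 ((\<beta> + 1) * exp 1 * \<beta>\<^sup>2) * (S powr (\<beta> - 1) * (S - 1))"
      using S1 by (intro mult_right_mono mult_nonneg_nonneg) auto
    ultimately show ?thesis by linarith
  next
    case False
    define k where "k z = of_real \<beta> * deriv h z" for z
    have dh: "deriv h holomorphic_on ball 0 \<rho>" by (intro holomorphic_deriv h) auto
    have k: "k holomorphic_on ball 0 \<rho>" unfolding k_def by (intro holomorphic_intros dh)
    have kc: "taylor_coeff k n = of_real \<beta> * (of_nat (Suc n) * taylor_coeff h (Suc n))" for n
      unfolding k_def using \<rho> by (subst taylor_coeff_cmult[OF dh]) (auto simp: taylor_coeff_deriv[OF h])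
    have d\<kappa>: "taylor_coeff (\<lambda>z. exp (of_real (\<beta> - 1) * l z) * k z) n = of_nat (Suc n) * taylor_coeff \<kappa> (Suc n)" for n
    proof -
      have "taylor_coeff (\<lambda>z. exp (of_real (\<beta> - 1) * l z) * k z) n = taylor_coeff (deriv \<kappa>) n"
        using \<rho> deriv_exp_powr_factor[OF l, of _ \<beta>] unfolding \<kappa>_def[abs_def] k_def h_def[abs_def]
        by (intro taylor_coeff_cong[of \<rho>]) (auto simp: mult_ac)
      then show ?thesis using taylor_coeff_deriv[OF \<kappa>] \<rho> by simp
    qed
    have ksum: "(\<Sum>n. (norm (taylor_coeff k n))\<^sup>2 / (real (n + 1) * real (n + 2))) \<le> \<beta>\<^sup>2 * (S - 1)"
    proof -
      have t: "(\<lambda>n. \<beta>\<^sup>2 * (norm (taylor_coeff h (Suc n)))\<^sup>2) sums (\<beta>\<^sup>2 * (S - 1))"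
        by (intro sums_mult tail)
      have le: "(norm (taylor_coeff k n))\<^sup>2 / (real (n + 1) * real (n + 2)) \<le> \<beta>\<^sup>2 * (norm (taylor_coeff h (Suc n)))\<^sup>2" for n
      proof -
        have "(norm (taylor_coeff k n))\<^sup>2 = \<beta>\<^sup>2 * (norm (taylor_coeff h (Suc n)))\<^sup>2 * (real (n + 1))\<^sup>2"
          unfolding kc norm_mult power_mult_distrib norm_of_nat by simp
        moreover have "(real (n + 1))\<^sup>2 / (real (n + 1) * real (n + 2)) \<le> 1"
          by (simp add: power2_eq_square)
        ultimately show ?thesis
          by (simp only: times_divide_eq_right[symmetric]) (intro mult_left_le; simp)
      qed
      have "summable (\<lambda>n. (norm (taylor_coeff k n))\<^sup>2 / (real (n + 1) * real (n + 2)))"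
        using le by (intro summable_comparison_test'[OF sums_summable[OF t], of 0]) simp
      from suminf_le[OF le this sums_summable[OF t]] show ?thesis
        using sums_unique[OF t] by simp
    qed
    have "(\<Sum>n<N. (norm (taylor_coeff \<kappa> (Suc n)))\<^sup>2 * real (n + 2) powr (-(\<beta> + 2)))
        \<le> (\<Sum>n\<le>N. (norm (taylor_coeff \<kappa> (Suc n)))\<^sup>2 * real (n + 2) powr (-(\<beta> + 2)))"
      by (intro sum_mono2) auto
    also have "\<dots> \<le> (\<Sum>n\<le>N. (norm (taylor_coeff (\<lambda>z. exp (of_real (\<beta> - 1) * l z) * k z) n))\<^sup>2 * real (n + 1) powr (-((\<beta> - 1) + 2)))"
    proof (rule sum_mono)
      fix n
      have "real (n + 2) powr (-(\<beta> + 2)) \<le> real (n + 1) powr (-(\<beta> + 2))"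
        using \<beta> by (intro powr_mono2') auto
      also have "\<dots> \<le> real (n + 1) powr (2 - (\<beta> + 1))" using \<beta> by (intro powr_mono) auto
      also have "\<dots> = (real (n + 1))\<^sup>2 * real (n + 1) powr (-((\<beta> - 1) + 2))"
      proof -
        have "(real (n + 1))\<^sup>2 = real (n + 1) powr 2" by (simp add: powr_numeral)
        then show ?thesis by (simp only: flip: powr_add) simp
      qed
      finally show "(norm (taylor_coeff \<kappa> (Suc n)))\<^sup>2 * real (n + 2) powr (-(\<beta> + 2))
         \<le> (norm (taylor_coeff (\<lambda>z. exp (of_real (\<beta> - 1) * l z) * k z) n))\<^sup>2 * real (n + 1) powr (-((\<beta> - 1) + 2))"
        unfolding d\<kappa> norm_mult power_mult_distrib norm_of_nat
        by (simp only: Suc_eq_plus1 mult.commute[of "(real (n+1))\<^sup>2"] mult.assoc) (intro mult_left_mono; simp)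
    qed
    also have "\<dots> \<le> ((\<beta> - 1) + 2) * exp 1 * S powr (\<beta> - 1) * (\<Sum>n. (norm (taylor_coeff k n))\<^sup>2 / (real (n + 1) * real (n + 2)))"
      unfolding S_def using False by (intro exp_multiplier_weighted[OF l k \<rho>]) auto
    also have "\<dots> \<le> ((\<beta> - 1) + 2) * exp 1 * S powr (\<beta> - 1) * (\<beta>\<^sup>2 * (S - 1))"
      using \<beta> by (intro mult_left_mono ksum) auto
    finally have "(\<Sum>n<N. (norm (taylor_coeff \<kappa> (Suc n)))\<^sup>2 * real (n + 2) powr (-(\<beta> + 2)))
       \<le> ((\<beta> + 1) * exp 1 * \<beta>\<^sup>2) * (S powr (\<beta> - 1) * (S - 1))"
      by (simp add: ac_simps)
    also have "\<dots> \<le> max 1 ((\<beta> + 1) * exp 1 * \<beta>\<^sup>2) * (S powr (\<beta> - 1) * (S - 1))"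
      using S1 by (intro mult_right_mono mult_nonneg_nonneg) auto
    finally show ?thesis .
  qed
  also have "\<dots> \<le> (1 + (\<beta> + 1) * exp 1 * \<beta>\<^sup>2) * (S powr (\<beta> - 1) * (S - 1))"
    using S1 \<beta> by (intro mult_right_mono mult_nonneg_nonneg) auto
  finally show ?thesis unfolding \<kappa>_def .
qed

section \<open>The inequality for zero-free functions\<close>

lemma norm_add_square_le: "(norm (a + b))\<^sup>2 \<le> 2 * ((norm a)\<^sup>2 + (norm b)\<^sup>2)" for a b :: complex
proof -
  have "(norm (a + b))\<^sup>2 \<le> (norm a + norm b)\<^sup>2"
    by (intro power_mono norm_triangle_ineq) auto
  also have "\<dots> \<le> 2 * ((norm a)\<^sup>2 + (norm b)\<^sup>2)"
    using sum_squares_bound[of "norm a" "norm b"] by (simp add: power2_sum)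
  finally show ?thesis .
qed

text \<open>Finite sections are used because every estimate below is uniform in \<open>N\<close>, while the summability of
  the full tail only follows at the end.\<close>

definition weighted_tail :: "real \<Rightarrow> nat \<Rightarrow> (complex \<Rightarrow> complex) \<Rightarrow> real" where
  "weighted_tail \<gamma> N f = (\<Sum>n<N. (norm (taylor_coeff f (n + 2)))\<^sup>2 * real (n + 3) powr (-\<gamma>))"

text \<open>Split \<open>(h\<^sup>\<alpha>)' / \<alpha>\<close>, where \<open>h = exp l\<close>, as \<open>h\<^sup>\<beta> (h' - h\<^sub>1) + h\<^sub>1 h\<^sup>\<beta>\<close> with \<open>\<beta> = \<alpha> - 1\<close>.  The function
  \<open>h' - h\<^sub>1\<close> carries only the coefficients of \<open>h\<close> from the second on, which is what makes the first
  summand proportional to \<open>S - 1 - y\<close>.  The second summand enters only through its coefficients of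
  positive index.\<close>

lemma exp_power_tail:
  fixes \<alpha> :: real
  assumes l: "l holomorphic_on ball 0 \<rho>" and \<rho>: "1 < \<rho>" and l0: "l 0 = 0" and \<alpha>: "1 < \<alpha>"
  defines "S \<equiv> circle_mean (\<lambda>z. (norm (exp (l z)))\<^sup>2)"
    and "y \<equiv> (norm (taylor_coeff (\<lambda>z. exp (l z)) 1))\<^sup>2"
  shows "weighted_tail (\<alpha> - 1) N (\<lambda>z. exp (of_real \<alpha> * l z))
     \<le> 2 * \<alpha>\<^sup>2 * ((\<alpha> + 1) * exp 1 * (S powr (\<alpha> - 1) * (S - 1 - y))
         + y * ((1 + \<alpha> * exp 1 * (\<alpha> - 1)\<^sup>2) * (S powr (\<alpha> - 2) * (S - 1))))"
proof -
  define \<beta> where "\<beta> = \<alpha> - 1"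
  have \<beta>: "0 < \<beta>" using \<alpha> by (simp add: \<beta>_def)
  define h where "h z = exp (l z)" for z
  define g where "g z = exp (of_real \<alpha> * l z)" for z
  define \<kappa> where "\<kappa> z = exp (of_real \<beta> * l z)" for z
  define h1 where "h1 = taylor_coeff h 1"
  define k where "k z = deriv h z - h1" for z
  define p where "p z = exp (of_real \<beta> * l z) * k z" for z
  have y: "y = (norm h1)\<^sup>2" by (simp add: y_def h1_def h_def[abs_def])
  have h: "h holomorphic_on ball 0 \<rho>" and g: "g holomorphic_on ball 0 \<rho>" and \<kappa>: "\<kappa> holomorphic_on ball 0 \<rho>"
    unfolding h_def g_def \<kappa>_def by (intro holomorphic_intros l)+
  have dh: "deriv h holomorphic_on ball 0 \<rho>" by (intro holomorphic_deriv h) auto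
  have k: "k holomorphic_on ball 0 \<rho>" unfolding k_def by (intro holomorphic_intros dh)
  have p: "p holomorphic_on ball 0 \<rho>" unfolding p_def by (intro holomorphic_intros l k)
  have kc: "taylor_coeff k n = (if n = 0 then 0 else of_nat (Suc n) * taylor_coeff h (Suc n))" for n
    unfolding k_def using \<rho>
    by (subst taylor_coeff_diff[OF dh]) (auto simp: taylor_coeff_deriv[OF h] taylor_coeff_const h1_def)
  have coeff: "of_nat (Suc n) * taylor_coeff g (Suc n) = of_real \<alpha> * (taylor_coeff p n + h1 * taylor_coeff \<kappa> n)" for n
  proof -
    have "of_nat (Suc n) * taylor_coeff g (Suc n) = taylor_coeff (deriv g) n"
      using taylor_coeff_deriv[OF g] \<rho> by simp
    also have "\<dots> = taylor_coeff (\<lambda>z. of_real \<alpha> * (p z + h1 * \<kappa> z)) n"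
      using \<rho> deriv_exp_powr_factor[OF l, of _ \<alpha>] unfolding g_def[abs_def] p_def \<kappa>_def k_def \<beta>_def h_def[abs_def]
      by (intro taylor_coeff_cong[of \<rho>]) (auto simp: algebra_simps)
    also have "\<dots> = of_real \<alpha> * taylor_coeff (\<lambda>z. p z + h1 * \<kappa> z) n"
      using \<rho> by (intro taylor_coeff_cmult[of _ \<rho>] holomorphic_intros p \<kappa>) auto
    also have "taylor_coeff (\<lambda>z. p z + h1 * \<kappa> z) n = taylor_coeff p n + taylor_coeff (\<lambda>z. h1 * \<kappa> z) n"
      using \<rho> by (intro taylor_coeff_add[of _ \<rho>] holomorphic_intros p \<kappa>) auto
    also have "taylor_coeff (\<lambda>z. h1 * \<kappa> z) n = h1 * taylor_coeff \<kappa> n"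
      using \<rho> by (intro taylor_coeff_cmult[of _ \<rho>] \<kappa>) auto
    finally show ?thesis .
  qed
  have coeff_le: "(norm (taylor_coeff g (n + 2)))\<^sup>2 * real (n + 3) powr (-(\<alpha> - 1))
      \<le> 2 * \<alpha>\<^sup>2 * ((norm (taylor_coeff p (Suc n)))\<^sup>2 * real (n + 2) powr (-(\<beta> + 2))
          + y * ((norm (taylor_coeff \<kappa> (Suc n)))\<^sup>2 * real (n + 2) powr (-(\<beta> + 2))))" for n
  proof -
    have "real (n + 3) powr (-(\<alpha> - 1)) \<le> real (n + 2) powr (-(\<alpha> - 1))"
      using \<alpha> by (intro powr_mono2') auto
    also have "\<dots> = (real (n + 2))\<^sup>2 * real (n + 2) powr (-(\<beta> + 2))"
    proof -
      have "(real (n + 2))\<^sup>2 = real (n + 2) powr 2" by (simp add: powr_numeral)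
      then show ?thesis by (simp only: flip: powr_add) (simp add: \<beta>_def)
    qed
    finally have "(norm (taylor_coeff g (n + 2)))\<^sup>2 * real (n + 3) powr (-(\<alpha> - 1))
        \<le> (norm (taylor_coeff g (n + 2)))\<^sup>2 * ((real (n + 2))\<^sup>2 * real (n + 2) powr (-(\<beta> + 2)))"
      by (intro mult_left_mono) auto
    also have "\<dots> = (norm (of_nat (Suc (Suc n)) * taylor_coeff g (Suc (Suc n))))\<^sup>2 * real (n + 2) powr (-(\<beta> + 2))"
      unfolding norm_mult power_mult_distrib norm_of_nat by (simp add: mult_ac)
    also have "\<dots> = \<alpha>\<^sup>2 * (norm (taylor_coeff p (Suc n) + h1 * taylor_coeff \<kappa> (Suc n)))\<^sup>2 * real (n + 2) powr (-(\<beta> + 2))"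
      unfolding coeff by (simp add: norm_mult power_mult_distrib)
    also have "\<dots> \<le> \<alpha>\<^sup>2 * (2 * ((norm (taylor_coeff p (Suc n)))\<^sup>2 + (norm (h1 * taylor_coeff \<kappa> (Suc n)))\<^sup>2)) * real (n + 2) powr (-(\<beta> + 2))"
      by (intro mult_right_mono mult_left_mono norm_add_square_le) auto
    finally show ?thesis
      by (simp add: y norm_mult power_mult_distrib algebra_simps)
  qed
  have sum_p: "(\<Sum>n<N. (norm (taylor_coeff p (Suc n)))\<^sup>2 * real (n + 2) powr (-(\<beta> + 2)))
      \<le> (\<alpha> + 1) * exp 1 * (S powr (\<alpha> - 1) * (S - 1 - y))"
  proof -
    define t where "t n = (if n = 0 then 0 else (norm (taylor_coeff h (Suc n)))\<^sup>2)" for n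
    have t: "t sums (S - 1 - y)"
    proof -
      have "(\<lambda>n. t (Suc n)) sums (S - 1 - y)"
        using mean_norm_square_split[OF h \<rho>, of 2]
        by (simp add: t_def S_def y numeral_2_eq_2 lessThan_Suc taylor_coeff_0 h_def[symmetric] h1_def)
           (simp add: h_def l0 algebra_simps)
      then have "t sums (S - 1 - y + t 0)" by (simp only: sums_Suc_iff)
      then show ?thesis by (simp add: t_def)
    qed
    have le: "(norm (taylor_coeff k n))\<^sup>2 / (real (n + 1) * real (n + 2)) \<le> t n" for n
    proof (cases "n = 0")
      case False
      have "(norm (taylor_coeff k n))\<^sup>2 = t n * (real (n + 1))\<^sup>2"
        using False unfolding kc by (simp add: norm_mult power_mult_distrib t_def del: of_nat_Suc)
      moreover have "(real (n + 1))\<^sup>2 / (real (n + 1) * real (n + 2)) \<le> 1"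
        by (simp add: power2_eq_square)
      ultimately show ?thesis
        by (simp only: times_divide_eq_right[symmetric]) (intro mult_left_le; simp add: t_def)
    qed (simp add: kc t_def)
    have "summable (\<lambda>n. (norm (taylor_coeff k n))\<^sup>2 / (real (n + 1) * real (n + 2)))"
      using le by (intro summable_comparison_test'[OF sums_summable[OF t], of 0]) simp
    from suminf_le[OF le this sums_summable[OF t]]
    have ksum: "(\<Sum>n. (norm (taylor_coeff k n))\<^sup>2 / (real (n + 1) * real (n + 2))) \<le> S - 1 - y"
      using sums_unique[OF t] by simp
    have "(\<Sum>n<N. (norm (taylor_coeff p (Suc n)))\<^sup>2 * real (n + 2) powr (-(\<beta> + 2)))
       \<le> (\<Sum>n\<le>N. (norm (taylor_coeff p n))\<^sup>2 * real (n + 1) powr (-(\<beta> + 2)))"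
      unfolding lessThan_Suc_atMost[symmetric] sum.lessThan_Suc_shift by (simp add: add.commute)
    also have "\<dots> \<le> (\<beta> + 2) * exp 1 * S powr \<beta> * (\<Sum>n. (norm (taylor_coeff k n))\<^sup>2 / (real (n + 1) * real (n + 2)))"
      unfolding p_def S_def using \<beta> by (intro exp_multiplier_weighted[OF l k \<rho>]) auto
    also have "\<dots> \<le> (\<beta> + 2) * exp 1 * S powr \<beta> * (S - 1 - y)"
      using \<beta> by (intro mult_left_mono ksum) auto
    finally show ?thesis by (simp add: \<beta>_def ac_simps)
  qed
  have sum_\<kappa>: "(\<Sum>n<N. (norm (taylor_coeff \<kappa> (Suc n)))\<^sup>2 * real (n + 2) powr (-(\<beta> + 2)))
      \<le> (1 + \<alpha> * exp 1 * (\<alpha> - 1)\<^sup>2) * (S powr (\<alpha> - 2) * (S - 1))"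
    using exp_power_minus_one_weighted[OF l \<rho> l0 \<beta>, of N] unfolding \<kappa>_def S_def by (simp add: \<beta>_def)
  have "(\<Sum>n<N. (norm (taylor_coeff g (n + 2)))\<^sup>2 * real (n + 3) powr (-(\<alpha> - 1)))
     \<le> (\<Sum>n<N. 2 * \<alpha>\<^sup>2 * ((norm (taylor_coeff p (Suc n)))\<^sup>2 * real (n + 2) powr (-(\<beta> + 2))
          + y * ((norm (taylor_coeff \<kappa> (Suc n)))\<^sup>2 * real (n + 2) powr (-(\<beta> + 2)))))"
    by (intro sum_mono coeff_le)
  also have "\<dots> = 2 * \<alpha>\<^sup>2 * ((\<Sum>n<N. (norm (taylor_coeff p (Suc n)))\<^sup>2 * real (n + 2) powr (-(\<beta> + 2)))
          + y * (\<Sum>n<N. (norm (taylor_coeff \<kappa> (Suc n)))\<^sup>2 * real (n + 2) powr (-(\<beta> + 2))))"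
    by (simp only: sum_distrib_left sum.distrib distrib_left)
  also have "\<dots> \<le> 2 * \<alpha>\<^sup>2 * ((\<alpha> + 1) * exp 1 * (S powr (\<alpha> - 1) * (S - 1 - y))
         + y * ((1 + \<alpha> * exp 1 * (\<alpha> - 1)\<^sup>2) * (S powr (\<alpha> - 2) * (S - 1))))"
    by (intro mult_left_mono add_mono sum_p sum_\<kappa>) (auto simp: y)
  finally show ?thesis unfolding g_def[abs_def] weighted_tail_def .
qed

text \<open>The second-order remainder of \<open>x\<^sup>\<alpha>\<close> at \<open>1\<close>, bounded below uniformly for small and large \<open>S\<close>.  The
  bound for the derivative is \<open>first_order\<close>; integrating it costs the factor \<open>2 + \<alpha>\<close> in the
  constant.\<close>

lemma powr_convexity_gap:
  fixes \<alpha> :: real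
  assumes \<alpha>: "1 < \<alpha>"
  obtains c where "c > 0" "\<And>S. 1 \<le> S \<Longrightarrow> c * ((S - 1)\<^sup>2 * S powr (\<alpha> - 2)) \<le> S powr \<alpha> - 1 - \<alpha> * (S - 1)"
proof
  define d where "d = min 1 (\<alpha> - 1)"
  define c where "c = \<alpha> * d / (2 + \<alpha>)"
  have d: "d > 0" "d \<le> 1" "d \<le> \<alpha> - 1" using \<alpha> by (auto simp: d_def)
  show c: "c > 0" using d \<alpha> by (simp add: c_def)
  have first_order: "d * ((S - 1) * S powr (\<alpha> - 2)) \<le> S powr (\<alpha> - 1) - 1" if S: "1 \<le> S" for S
  proof -
    have "S powr (2 - \<alpha>) \<le> 1 + (1 - d) * (S - 1)"
    proof (cases "\<alpha> \<ge> 2")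
      case True
      then show ?thesis using powr_mono[of "2 - \<alpha>" 0 S] S by (simp add: d_def)
    next
      case False
      then show ?thesis using powr_le_affine[of S "2 - \<alpha>"] S \<alpha> by (simp add: d_def)
    qed
    then have "d * (S - 1) \<le> S - S powr (2 - \<alpha>)" by (simp add: algebra_simps)
    then have "d * (S - 1) * S powr (\<alpha> - 2) \<le> (S - S powr (2 - \<alpha>)) * S powr (\<alpha> - 2)"
      by (intro mult_right_mono) auto
    also have "\<dots> = S powr (\<alpha> - 1) - 1"
    proof -
      have "S * S powr (\<alpha> - 2) = S powr (\<alpha> - 1)" using S powr_add[of S 1 "\<alpha> - 2"] by simp
      moreover have "S powr (2 - \<alpha>) * S powr (\<alpha> - 2) = 1" using S by (simp flip: powr_add)
      ultimately show ?thesis by (simp add: left_diff_distrib)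
    qed
    finally show ?thesis by (simp add: mult.assoc)
  qed
  fix S :: real assume S: "1 \<le> S"
  define F where "F S = S powr \<alpha> - 1 - \<alpha> * (S - 1) - c * ((S - 1)\<^sup>2 * S powr (\<alpha> - 2))" for S
  define F' where "F' S = \<alpha> * S powr (\<alpha> - 1) - \<alpha> - c * (2 * (S - 1) * S powr (\<alpha> - 2) + (S - 1)\<^sup>2 * ((\<alpha> - 2) * S powr (\<alpha> - 3)))" for S
  have "F 1 \<le> F S"
  proof (rule DERIV_nonneg_imp_nondecreasing[OF S])
    fix x :: real assume x: "1 \<le> x" "x \<le> S"
    have "(F has_real_derivative F' x) (at x)"
      unfolding F_def F'_def using x
      by (auto intro!: derivative_eq_intros simp: algebra_simps)
    moreover have "F' x \<ge> 0"
    proof -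
      have "(x - 1)\<^sup>2 * ((\<alpha> - 2) * x powr (\<alpha> - 3)) \<le> \<alpha> * ((x - 1) * x powr (\<alpha> - 2))"
      proof -
        have "(x - 1)\<^sup>2 * ((\<alpha> - 2) * x powr (\<alpha> - 3)) = (\<alpha> - 2) * ((x - 1) * x powr (\<alpha> - 3)) * (x - 1)"
          by (simp add: power2_eq_square mult_ac)
        also have "\<dots> \<le> \<alpha> * (x * x powr (\<alpha> - 3)) * (x - 1)"
          using x \<alpha> by (intro mult_right_mono mult_mono) auto
        also have "x * x powr (\<alpha> - 3) = x powr (\<alpha> - 2)"
          using x powr_add[of x 1 "\<alpha> - 3"] by simp
        finally show ?thesis by (simp add: mult_ac)
      qed
      then have "2 * (x - 1) * x powr (\<alpha> - 2) + (x - 1)\<^sup>2 * ((\<alpha> - 2) * x powr (\<alpha> - 3)) \<le> (2 + \<alpha>) * ((x - 1) * x powr (\<alpha> - 2))"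
        unfolding distrib_right[of 2 \<alpha>] mult.assoc by simp
      then have "c * (2 * (x - 1) * x powr (\<alpha> - 2) + (x - 1)\<^sup>2 * ((\<alpha> - 2) * x powr (\<alpha> - 3))) \<le> c * ((2 + \<alpha>) * ((x - 1) * x powr (\<alpha> - 2)))"
        using c by (intro mult_left_mono) auto
      also have "\<dots> = \<alpha> * (d * ((x - 1) * x powr (\<alpha> - 2)))"
        using \<alpha> by (simp add: c_def)
      also have "\<dots> \<le> \<alpha> * (x powr (\<alpha> - 1) - 1)"
        using first_order[OF x(1)] \<alpha> by (intro mult_left_mono) auto
      finally show ?thesis by (simp add: F'_def algebra_simps)
    qed
    ultimately show "\<exists>y. (F has_real_derivative y) (at x) \<and> 0 \<le> y" by blast
  qed
  then show "c * ((S - 1)\<^sup>2 * S powr (\<alpha> - 2)) \<le> S powr \<alpha> - 1 - \<alpha> * (S - 1)"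
    by (simp add: F_def)
qed

text \<open>The gap on the right is \<open>\<alpha> (S - 1 - y)\<close> plus the convexity gap at \<open>S\<close>.  The first part controls
  \<open>S powr (\<alpha> - 1) * (S - 1 - y)\<close> while \<open>S\<close> is bounded; for \<open>S \<ge> 2\<close> the convexity gap is
  of the full order \<open>S\<^sup>\<alpha>\<close>.\<close>

lemma powr_deficit_dominates:
  fixes \<alpha> :: real
  assumes \<alpha>: "1 < \<alpha>"
  obtains C where "C > 0" "\<And>S y. \<lbrakk>1 \<le> S; 0 \<le> y; y \<le> S - 1\<rbrakk> \<Longrightarrow>
     S powr (\<alpha> - 1) * (S - 1 - y) + y * (S powr (\<alpha> - 2) * (S - 1)) \<le> C * (S powr \<alpha> - 1 - \<alpha> * y)"
proof -
  obtain c where c: "c > 0" "\<And>S. 1 \<le> S \<Longrightarrow> c * ((S - 1)\<^sup>2 * S powr (\<alpha> - 2)) \<le> S powr \<alpha> - 1 - \<alpha> * (S - 1)"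
    using powr_convexity_gap[OF \<alpha>] by blast
  define C where "C = 2 powr (\<alpha> - 1) / \<alpha> + 3 / c"
  have bound: "S powr (\<alpha> - 1) * (S - 1 - y) + y * (S powr (\<alpha> - 2) * (S - 1)) \<le> C * (S powr \<alpha> - 1 - \<alpha> * y)"
    if S: "1 \<le> S" and y: "0 \<le> y" "y \<le> S - 1" for S y
  proof -
    define E where "E = S powr \<alpha> - 1 - \<alpha> * y"
    define G where "G = (S - 1)\<^sup>2 * S powr (\<alpha> - 2)"
    have cG: "c * G + \<alpha> * (S - 1 - y) \<le> E"
      using c(2)[OF S] by (simp add: E_def G_def algebra_simps)
    have G0: "G \<ge> 0" by (simp add: G_def)
    have R0: "\<alpha> * (S - 1 - y) \<ge> 0" using \<alpha> y by simp
    have G: "G \<le> E / c" using cG R0 c(1) by (simp add: field_simps)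
    have R: "S - 1 - y \<le> E / \<alpha>" using cG mult_nonneg_nonneg[OF less_imp_le[OF c(1)] G0] \<alpha> by (simp add: field_simps)
    have E0: "E \<ge> 0" using cG R0 mult_nonneg_nonneg[OF less_imp_le[OF c(1)] G0] by linarith
    have "y * (S powr (\<alpha> - 2) * (S - 1)) \<le> (S - 1) * (S powr (\<alpha> - 2) * (S - 1))"
      using S y by (intro mult_right_mono) auto
    then have 1: "y * (S powr (\<alpha> - 2) * (S - 1)) \<le> E / c"
      using G by (simp add: G_def power2_eq_square mult_ac)
    have 2: "S powr (\<alpha> - 1) * (S - 1 - y) \<le> 2 powr (\<alpha> - 1) / \<alpha> * E + 2 * (E / c)"
    proof (cases "S \<le> 2")
      case True
      have "S powr (\<alpha> - 1) * (S - 1 - y) \<le> 2 powr (\<alpha> - 1) * (E / \<alpha>)"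
        using R True S y \<alpha> by (intro mult_mono powr_mono2) auto
      then show ?thesis using E0 c(1) by (simp add: add_increasing2)
    next
      case False
      have "S powr (\<alpha> - 1) = S * S powr (\<alpha> - 2)" using S powr_add[of S 1 "\<alpha> - 2"] by simp
      then have "S powr (\<alpha> - 1) * (S - 1 - y) = S powr (\<alpha> - 2) * (S * (S - 1 - y))" by (simp add: mult_ac)
      also have "\<dots> \<le> S powr (\<alpha> - 2) * (2 * (S - 1) * (S - 1))"
        using False y S by (intro mult_left_mono mult_mono) auto
      also have "\<dots> = 2 * G" by (simp add: G_def power2_eq_square mult_ac)
      finally have "S powr (\<alpha> - 1) * (S - 1 - y) \<le> 2 * (E / c)" using G by simp
      moreover have "0 \<le> 2 powr (\<alpha> - 1) / \<alpha> * E" using E0 \<alpha> by simp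
      ultimately show ?thesis by linarith
    qed
    have "C * E = 2 powr (\<alpha> - 1) / \<alpha> * E + 3 * (E / c)" by (simp add: C_def distrib_right)
    with 1 2 show ?thesis unfolding E_def[symmetric] by linarith
  qed
  have "C > 0" using \<alpha> c(1) by (simp add: C_def add_pos_pos)
  from that[OF this bound] show ?thesis .
qed

lemma zero_free_inequality:
  fixes \<alpha> :: real
  assumes \<alpha>: "1 < \<alpha>"
  obtains C where "C > 0" "\<And>l \<rho> N. \<lbrakk>l holomorphic_on ball 0 \<rho>; 1 < \<rho>; l 0 = 0\<rbrakk> \<Longrightarrow>
     weighted_tail (\<alpha> - 1) N (\<lambda>z. exp (of_real \<alpha> * l z))
     \<le> C * (circle_mean (\<lambda>z. (norm (exp (l z)))\<^sup>2) powr \<alpha> - 1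
            - (norm (taylor_coeff (\<lambda>z. exp (of_real \<alpha> * l z)) 1))\<^sup>2 / \<alpha>)"
proof -
  obtain K where K: "K > 0" "\<And>S y. \<lbrakk>1 \<le> S; 0 \<le> y; y \<le> S - 1\<rbrakk> \<Longrightarrow>
     S powr (\<alpha> - 1) * (S - 1 - y) + y * (S powr (\<alpha> - 2) * (S - 1)) \<le> K * (S powr \<alpha> - 1 - \<alpha> * y)"
    using powr_deficit_dominates[OF \<alpha>] by blast
  define A where "A = 2 * \<alpha>\<^sup>2 * ((\<alpha> + 1) * exp 1 + (1 + \<alpha> * exp 1 * (\<alpha> - 1)\<^sup>2))"
  have A: "A > 0" using \<alpha> unfolding A_def by (intro mult_pos_pos add_pos_nonneg mult_nonneg_nonneg) auto
  have bound: "weighted_tail (\<alpha> - 1) N (\<lambda>z. exp (of_real \<alpha> * l z))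
     \<le> A * K * (circle_mean (\<lambda>z. (norm (exp (l z)))\<^sup>2) powr \<alpha> - 1
            - (norm (taylor_coeff (\<lambda>z. exp (of_real \<alpha> * l z)) 1))\<^sup>2 / \<alpha>)"
    if l: "l holomorphic_on ball 0 \<rho>" and \<rho>: "1 < \<rho>" and l0: "l 0 = 0" for l \<rho> N
  proof -
    define h where "h z = exp (l z)" for z
    define g where "g z = exp (of_real \<alpha> * l z)" for z
    define S where "S = circle_mean (\<lambda>z. (norm (exp (l z)))\<^sup>2)"
    define y where "y = (norm (taylor_coeff (\<lambda>z. exp (l z)) 1))\<^sup>2"
    have h: "h holomorphic_on ball 0 \<rho>" and g: "g holomorphic_on ball 0 \<rho>"
      unfolding h_def g_def by (intro holomorphic_intros l)+
    have g1: "(norm (taylor_coeff g 1))\<^sup>2 / \<alpha> = \<alpha> * y"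
    proof -
      have "deriv g 0 = of_real \<alpha> * deriv h 0"
        using deriv_exp_powr_factor[OF l, of 0 \<alpha>] \<rho> by (simp add: g_def[abs_def] h_def[abs_def] l0)
      then have "taylor_coeff g 1 = of_real \<alpha> * taylor_coeff h 1"
        by (simp add: taylor_coeff_def fps_expansion_def)
      then show ?thesis using \<alpha> by (simp add: y_def h_def[abs_def] norm_mult power_mult_distrib power2_eq_square)
    qed
    have tail: "(\<lambda>n. (norm (taylor_coeff h (n + 2)))\<^sup>2) sums (S - 1 - y)"
      using mean_norm_square_split[OF h \<rho>, of 2]
      by (simp add: S_def y_def numeral_2_eq_2 lessThan_Suc taylor_coeff_0 h_def[abs_def] l0 algebra_simps)
    have yS: "y \<le> S - 1" using sums_le[OF _ sums_zero tail] by simp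
    have y0: "0 \<le> y" by (simp add: y_def)
    define X where "X = S powr (\<alpha> - 1) * (S - 1 - y)"
    define Y where "Y = y * (S powr (\<alpha> - 2) * (S - 1))"
    have X0: "X \<ge> 0" "Y \<ge> 0" using yS y0 by (auto simp: X_def Y_def)
    have "weighted_tail (\<alpha> - 1) N g
      \<le> 2 * \<alpha>\<^sup>2 * ((\<alpha> + 1) * exp 1 * X + (1 + \<alpha> * exp 1 * (\<alpha> - 1)\<^sup>2) * Y)"
      using exp_power_tail[OF l \<rho> l0 \<alpha>, of N] unfolding X_def Y_def S_def y_def g_def by (simp add: mult_ac)
    also have "\<dots> \<le> A * (X + Y)"
    proof -
      have "0 \<le> 2 * \<alpha>\<^sup>2 * ((\<alpha> + 1) * exp 1 * Y + (1 + \<alpha> * exp 1 * (\<alpha> - 1)\<^sup>2) * X)"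
        using \<alpha> X0 by (intro mult_nonneg_nonneg add_nonneg_nonneg) auto
      then show ?thesis by (simp add: A_def algebra_simps)
    qed
    also have "\<dots> \<le> A * (K * (S powr \<alpha> - 1 - \<alpha> * y))"
      using K(2)[of S y] yS y0 A unfolding X_def Y_def by (intro mult_left_mono) auto
    finally show ?thesis
      unfolding g1[symmetric] unfolding S_def g_def[abs_def] by (simp only: mult.assoc)
  qed
  show ?thesis
    by (rule that[OF _ bound]) (use A K(1) in auto)
qed

section \<open>Reinstating the zeros\<close>

lemma norm_add3_square_le: "(norm (a + b + c))\<^sup>2 \<le> 3 * ((norm a)\<^sup>2 + (norm b)\<^sup>2 + (norm c)\<^sup>2)" for a b c :: complex
proof -
  have "(norm (a + b + c))\<^sup>2 \<le> (norm a + norm b + norm c)\<^sup>2"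
    using norm_triangle_ineq[of "a + b" c] norm_triangle_ineq[of a b] by (intro power_mono) auto
  also have "\<dots> \<le> 3 * ((norm a)\<^sup>2 + (norm b)\<^sup>2 + (norm c)\<^sup>2)"
    using sum_squares_bound[of "norm a" "norm b"] sum_squares_bound[of "norm a" "norm c"]
      sum_squares_bound[of "norm b" "norm c"] by (simp add: power2_eq_square algebra_simps)
  finally show ?thesis .
qed

text \<open>Only \<open>g\<^sub>0 + g\<^sub>1 z\<close> can be moved by \<open>B\<close> into degrees above one at a cost that is not already counted
  in the tail of \<open>g\<close>, and there the constant term of \<open>B\<close> drops out, leaving coefficients of \<open>B\<close> of
  total square at most \<open>1 - |B 0|\<^sup>2\<close>.  The tail of \<open>g\<close> itself does not grow under multiplication by \<open>B\<close>,
  the weights being decreasing.\<close>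

lemma multiplier_tail:
  fixes w :: "nat \<Rightarrow> real"
  assumes B: "B holomorphic_on ball 0 \<rho>" "1 < \<rho>" "\<And>z. norm z = 1 \<Longrightarrow> norm (B z) \<le> 1"
    and g: "g holomorphic_on ball 0 \<rho>"
    and w: "antimono w" "\<And>n. 0 \<le> w n" "\<And>n. w n \<le> 1"
  shows "(\<Sum>n<N. (norm (taylor_coeff (\<lambda>z. B z * g z) (n + 2)))\<^sup>2 * w (n + 2))
     \<le> 3 * ((\<Sum>n<N. (norm (taylor_coeff g (n + 2)))\<^sup>2 * w (n + 2))
            + (1 - (norm (B 0))\<^sup>2) * ((norm (taylor_coeff g 0))\<^sup>2 + (norm (taylor_coeff g 1))\<^sup>2))"
proof -
  define b where "b = taylor_coeff B"
  define t where "t j = (if j < 2 then 0 else taylor_coeff g j)" for j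
  define T where "T n = (\<Sum>i\<le>n. b i * t (n - i))" for n
  define g0 g1 where "g0 = taylor_coeff g 0" and "g1 = taylor_coeff g 1"
  have \<rho>: "0 < \<rho>" using B(2) by simp
  have coeff: "taylor_coeff (\<lambda>z. B z * g z) (n + 2) = T (n + 2) + b (n + 1) * g1 + b (n + 2) * g0" for n
  proof -
    have "(\<Sum>i\<le>n. b i * taylor_coeff g (n + 2 - i)) = (\<Sum>i\<le>n. b i * t (n + 2 - i))"
      by (intro sum.cong) (auto simp: t_def)
    then show ?thesis
      unfolding taylor_coeff_mult[OF B(1) g \<rho>] T_def b_def[symmetric]
      by (simp add: numeral_2_eq_2 t_def g0_def g1_def Suc_diff_le)
  qed
  have bsum: "(\<Sum>n<N. (norm (b (n + 1)))\<^sup>2) \<le> 1 - (norm (B 0))\<^sup>2" for N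
    using multiplier_coeffs_le_1[OF B, of N]
    unfolding lessThan_Suc_atMost[symmetric] sum.lessThan_Suc_shift by (simp add: b_def taylor_coeff_0)
  have bsum2: "(\<Sum>n<N. (norm (b (n + 2)))\<^sup>2) \<le> 1 - (norm (B 0))\<^sup>2"
  proof -
    have "(\<Sum>n<N. (norm (b (n + 2)))\<^sup>2) \<le> (\<Sum>n<Suc N. (norm (b (n + 1)))\<^sup>2)"
      unfolding sum.lessThan_Suc_shift by simp
    then show ?thesis using bsum[of "Suc N"] by linarith
  qed
  have Tsum: "(\<Sum>n<N. (norm (T (n + 2)))\<^sup>2 * w (n + 2)) \<le> (\<Sum>n<N. (norm (taylor_coeff g (n + 2)))\<^sup>2 * w (n + 2))"
  proof -
    have "(\<Sum>n<N. (norm (T (n + 2)))\<^sup>2 * w (n + 2)) \<le> (\<Sum>n<Suc (Suc N). w n * (norm (T n))\<^sup>2)"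
      unfolding sum.lessThan_Suc_shift using w(2) by (simp add: mult.commute add_nonneg_nonneg)
    also have "\<dots> \<le> (\<Sum>n<Suc (Suc N). w n * (norm (t n))\<^sup>2)"
      unfolding T_def lessThan_Suc_atMost b_def by (intro multiplier_weighted[OF B w(1,2)])
    also have "\<dots> = (\<Sum>n<N. (norm (taylor_coeff g (n + 2)))\<^sup>2 * w (n + 2))"
      unfolding sum.lessThan_Suc_shift by (simp add: t_def mult.commute)
    finally show ?thesis .
  qed
  have "(\<Sum>n<N. (norm (taylor_coeff (\<lambda>z. B z * g z) (n + 2)))\<^sup>2 * w (n + 2))
     \<le> (\<Sum>n<N. 3 * ((norm (T (n + 2)))\<^sup>2 * w (n + 2) + (norm (b (n + 1)))\<^sup>2 * (norm g1)\<^sup>2 + (norm (b (n + 2)))\<^sup>2 * (norm g0)\<^sup>2))"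
  proof (rule sum_mono)
    fix n
    have "(norm (taylor_coeff (\<lambda>z. B z * g z) (n + 2)))\<^sup>2 * w (n + 2)
      \<le> 3 * ((norm (T (n + 2)))\<^sup>2 + (norm (b (n + 1) * g1))\<^sup>2 + (norm (b (n + 2) * g0))\<^sup>2) * w (n + 2)"
      unfolding coeff using w(2) by (intro mult_right_mono norm_add3_square_le)
    also have "\<dots> = 3 * ((norm (T (n + 2)))\<^sup>2 * w (n + 2) + (norm (b (n + 1) * g1))\<^sup>2 * w (n + 2) + (norm (b (n + 2) * g0))\<^sup>2 * w (n + 2))"
      by (simp add: algebra_simps)
    also have "\<dots> \<le> 3 * ((norm (T (n + 2)))\<^sup>2 * w (n + 2) + (norm (b (n + 1) * g1))\<^sup>2 + (norm (b (n + 2) * g0))\<^sup>2)"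
      using w(2,3) by (intro mult_left_mono add_mono mult_left_le) auto
    finally show "(norm (taylor_coeff (\<lambda>z. B z * g z) (n + 2)))\<^sup>2 * w (n + 2)
      \<le> 3 * ((norm (T (n + 2)))\<^sup>2 * w (n + 2) + (norm (b (n + 1)))\<^sup>2 * (norm g1)\<^sup>2 + (norm (b (n + 2)))\<^sup>2 * (norm g0)\<^sup>2)"
      by (simp only: norm_mult power_mult_distrib)
  qed
  also have "\<dots> = 3 * ((\<Sum>n<N. (norm (T (n + 2)))\<^sup>2 * w (n + 2)) + (\<Sum>n<N. (norm (b (n + 1)))\<^sup>2) * (norm g1)\<^sup>2
       + (\<Sum>n<N. (norm (b (n + 2)))\<^sup>2) * (norm g0)\<^sup>2)"
    by (simp only: sum_distrib_left[symmetric] sum_distrib_right[symmetric] sum.distrib)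
  also have "\<dots> \<le> 3 * ((\<Sum>n<N. (norm (taylor_coeff g (n + 2)))\<^sup>2 * w (n + 2)) + (1 - (norm (B 0))\<^sup>2) * (norm g1)\<^sup>2
       + (1 - (norm (B 0))\<^sup>2) * (norm g0)\<^sup>2)"
    by (intro mult_left_mono add_mono mult_right_mono Tsum bsum bsum2) auto
  finally show ?thesis by (simp add: g0_def g1_def algebra_simps)
qed

text \<open>With \<open>b = |B 0|\<close>, inserting \<open>|B\<^sub>1| \<le> 1 - b\<^sup>2\<close> gives a gain of \<open>(1 - b\<^sup>2) ((\<alpha> - 1) + (s - b)\<^sup>2) / \<alpha>\<close>.
  Because \<open>\<alpha> > 1\<close>, the second factor is comparable to \<open>1 + s\<^sup>2\<close>, uniformly in \<open>b \<le> 1\<close>.\<close>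

lemma multiplier_deficit:
  assumes B: "B holomorphic_on ball 0 \<rho>" "1 < \<rho>" "\<And>z. norm z = 1 \<Longrightarrow> norm (B z) \<le> 1"
    and g: "g holomorphic_on ball 0 \<rho>" "g 0 = 1" and \<alpha>: "1 < \<alpha>"
  defines "s \<equiv> norm (taylor_coeff g 1)"
  shows "(norm (B 0))\<^sup>2 + (norm (taylor_coeff (\<lambda>z. B z * g z) 1))\<^sup>2 / \<alpha>
       + (1 - (norm (B 0))\<^sup>2) * (1 + s\<^sup>2) / (\<alpha> * (3 / (\<alpha> - 1) + 2)) \<le> 1 + s\<^sup>2 / \<alpha>"
proof -
  define b where "b = norm (B 0)"
  define K where "K = 3 / (\<alpha> - 1) + 2"
  have K: "K > 0" using \<alpha> by (simp add: K_def add_pos_pos)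
  have b0: "b \<ge> 0" by (simp add: b_def)
  have d: "norm (taylor_coeff B 1) \<le> 1 - b\<^sup>2"
    using multiplier_first_coeff[OF B] by (simp add: b_def taylor_coeff_0)
  have b1: "0 \<le> 1 - b\<^sup>2" using d by (rule order.trans[OF norm_ge_zero])
  then have b1': "b \<le> 1" using b0 by (simp add: power_le_one_iff)
  have "taylor_coeff (\<lambda>z. B z * g z) 1 = B 0 * taylor_coeff g 1 + taylor_coeff B 1"
    using B(2) by (subst taylor_coeff_mult[OF B(1) g(1)]) (auto simp: taylor_coeff_0 g(2))
  then have "norm (taylor_coeff (\<lambda>z. B z * g z) 1) \<le> b * s + (1 - b\<^sup>2)"
    using norm_triangle_ineq[of "B 0 * taylor_coeff g 1" "taylor_coeff B 1"] d by (simp add: norm_mult b_def s_def)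
  then have "(norm (taylor_coeff (\<lambda>z. B z * g z) 1))\<^sup>2 \<le> (b * s + (1 - b\<^sup>2))\<^sup>2"
    by (intro power_mono) auto
  moreover have "1 + s\<^sup>2 \<le> K * ((\<alpha> - 1) + (s - b)\<^sup>2)"
  proof -
    define q where "q = (s - b)\<^sup>2"
    have "s\<^sup>2 \<le> 2 * q + 2 * b\<^sup>2"
      unfolding q_def using zero_le_power2[of "s - 2 * b"] by (simp add: power2_eq_square algebra_simps)
    moreover have "0 \<le> 3 / (\<alpha> - 1) * q" using \<alpha> by (simp add: q_def)
    ultimately have "1 + s\<^sup>2 \<le> 3 + 2 * (\<alpha> - 1) + (3 / (\<alpha> - 1) * q + 2 * q)"
      using b1 \<alpha> by (smt (verit))
    also have "\<dots> = K * ((\<alpha> - 1) + q)"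
      using \<alpha> by (simp add: K_def algebra_simps add_divide_distrib[symmetric]) (simp add: field_simps)
    finally show ?thesis by (simp add: q_def)
  qed
  then have "(1 - b\<^sup>2) * ((1 + s\<^sup>2) / K) \<le> (1 - b\<^sup>2) * ((\<alpha> - 1) + (s - b)\<^sup>2)"
    using K b1 by (intro mult_left_mono) (auto simp: pos_divide_le_eq mult.commute)
  moreover have "\<alpha> + s\<^sup>2 - \<alpha> * b\<^sup>2 - (b * s + (1 - b\<^sup>2))\<^sup>2 = (1 - b\<^sup>2) * ((\<alpha> - 1) + (s - b)\<^sup>2)"
    by (simp add: power2_eq_square algebra_simps)
  ultimately have "\<alpha> * b\<^sup>2 + (norm (taylor_coeff (\<lambda>z. B z * g z) 1))\<^sup>2 + (1 - b\<^sup>2) * ((1 + s\<^sup>2) / K) \<le> \<alpha> + s\<^sup>2"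
    by linarith
  then have "(\<alpha> * b\<^sup>2 + (norm (taylor_coeff (\<lambda>z. B z * g z) 1))\<^sup>2 + (1 - b\<^sup>2) * ((1 + s\<^sup>2) / K)) / \<alpha> \<le> (\<alpha> + s\<^sup>2) / \<alpha>"
    using \<alpha> by (intro divide_right_mono) auto
  then have "b\<^sup>2 + (norm (taylor_coeff (\<lambda>z. B z * g z) 1))\<^sup>2 / \<alpha> + (1 - b\<^sup>2) * ((1 + s\<^sup>2) / K) / \<alpha> \<le> 1 + s\<^sup>2 / \<alpha>"
    using \<alpha> by (simp add: add_divide_distrib)
  moreover have "(1 - b\<^sup>2) * (1 + s\<^sup>2) / (\<alpha> * K) = (1 - b\<^sup>2) * ((1 + s\<^sup>2) / K) / \<alpha>"
    by (simp add: mult.commute)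
  ultimately show ?thesis by (simp only: b_def K_def)
qed

text \<open>The constant splits the available gap: the part \<open>E\<close> of the zero-free factor pays for its own tail,
  and the gain from \<open>multiplier_deficit\<close> pays for the tail that \<open>B\<close> creates.\<close>

lemma factored_inequality:
  fixes \<alpha> :: real
  assumes \<alpha>: "1 < \<alpha>"
  shows "\<exists>\<epsilon>>0. \<forall>B l \<rho> N. B holomorphic_on ball 0 \<rho> \<longrightarrow> 1 < \<rho> \<longrightarrow> (\<forall>z. norm z = 1 \<longrightarrow> norm (B z) \<le> 1) \<longrightarrow>
       l holomorphic_on ball 0 \<rho> \<longrightarrow> l 0 = 0 \<longrightarrow>
     (norm (B 0))\<^sup>2 + (norm (taylor_coeff (\<lambda>z. B z * exp (of_real \<alpha> * l z)) 1))\<^sup>2 / \<alpha>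
       + \<epsilon> * weighted_tail (\<alpha> - 1) N (\<lambda>z. B z * exp (of_real \<alpha> * l z))
     \<le> circle_mean (\<lambda>z. (norm (exp (l z)))\<^sup>2) powr \<alpha>"
proof -
  obtain C where C: "C > 0" "\<And>l \<rho> N. \<lbrakk>l holomorphic_on ball 0 \<rho>; 1 < \<rho>; l 0 = 0\<rbrakk> \<Longrightarrow>
     weighted_tail (\<alpha> - 1) N (\<lambda>z. exp (of_real \<alpha> * l z))
     \<le> C * (circle_mean (\<lambda>z. (norm (exp (l z)))\<^sup>2) powr \<alpha> - 1
            - (norm (taylor_coeff (\<lambda>z. exp (of_real \<alpha> * l z)) 1))\<^sup>2 / \<alpha>)"
    by (rule zero_free_inequality[OF \<alpha>]) (rule that)
  define K where "K = \<alpha> * (3 / (\<alpha> - 1) + 2)"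
  have K: "K > 0" using \<alpha> unfolding K_def by (intro mult_pos_pos add_pos_pos) auto
  define \<epsilon> where "\<epsilon> = 1 / (3 * (C + K))"
  have \<epsilon>: "\<epsilon> > 0" using C(1) K by (simp add: \<epsilon>_def)
  have \<epsilon>C: "\<epsilon> * (3 * C) \<le> 1" "\<epsilon> * 3 \<le> 1 / K"
    using C(1) K by (auto simp: \<epsilon>_def field_simps)
  show ?thesis
  proof (intro exI[of _ \<epsilon>] conjI allI impI \<epsilon>)
    fix B l :: "complex \<Rightarrow> complex" and \<rho> :: real and N
    assume B: "B holomorphic_on ball 0 \<rho>" "1 < \<rho>" and B_le: "\<forall>z. norm z = 1 \<longrightarrow> norm (B z) \<le> 1"
      and l: "l holomorphic_on ball 0 \<rho>" "l 0 = 0"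
    note B = B B_le[rule_format]
    define g where "g z = exp (of_real \<alpha> * l z)" for z
    define f where "f z = B z * g z" for z
    define S where "S = circle_mean (\<lambda>z. (norm (exp (l z)))\<^sup>2)"
    define w where "w n = real (n + 1) powr (-(\<alpha> - 1))" for n
    define s where "s = norm (taylor_coeff g 1)"
    define E where "E = S powr \<alpha> - 1 - s\<^sup>2 / \<alpha>"
    define b where "b = norm (B 0)"
    have g: "g holomorphic_on ball 0 \<rho>" unfolding g_def by (intro holomorphic_intros l)
    have g0: "g 0 = 1" by (simp add: g_def l)
    have w: "antimono w" "0 \<le> w n" "w n \<le> 1" for n
    proof -
      show "antimono w"
        unfolding w_def using \<alpha> by (intro antimonoI powr_mono2') auto
      show "0 \<le> w n" by (simp add: w_def)
      show "w n \<le> 1" using powr_mono[of "-(\<alpha> - 1)" 0 "real (n + 1)"] \<alpha> by (simp add: w_def)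
    qed
    have w2: "w (n + 2) = real (n + 3) powr (-(\<alpha> - 1))" for n by (simp add: w_def add.commute)
    have zf: "(\<Sum>n<N. (norm (taylor_coeff g (n + 2)))\<^sup>2 * w (n + 2)) \<le> C * E"
      using C(2)[OF l(1) B(2) l(2), of N] unfolding w2 E_def S_def s_def g_def[abs_def] weighted_tail_def .
    have E0: "E \<ge> 0"
      using C(2)[OF l(1) B(2) l(2), of 0] C(1) unfolding E_def S_def s_def g_def[abs_def] weighted_tail_def
      by (simp add: zero_le_mult_iff)
    have deficit: "b\<^sup>2 + (norm (taylor_coeff f 1))\<^sup>2 / \<alpha> + (1 - b\<^sup>2) * (1 + s\<^sup>2) / K \<le> 1 + s\<^sup>2 / \<alpha>"
      using multiplier_deficit[OF B g g0 \<alpha>] by (simp add: b_def s_def K_def f_def[abs_def])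
    have b1: "0 \<le> 1 - b\<^sup>2"
      using multiplier_coeffs_le_1[OF B, of 0] by (simp add: b_def taylor_coeff_0)
    have "(\<Sum>n<N. (norm (taylor_coeff f (n + 2)))\<^sup>2 * w (n + 2)) \<le> 3 * (C * E + (1 - b\<^sup>2) * (1 + s\<^sup>2))"
      using multiplier_tail[OF B g w, of N] zf by (simp add: f_def[abs_def] b_def s_def taylor_coeff_0 g0)
    then have "\<epsilon> * (\<Sum>n<N. (norm (taylor_coeff f (n + 2)))\<^sup>2 * w (n + 2)) \<le> \<epsilon> * (3 * (C * E + (1 - b\<^sup>2) * (1 + s\<^sup>2)))"
      using \<epsilon> by (intro mult_left_mono) auto
    also have "\<dots> = \<epsilon> * (3 * C) * E + \<epsilon> * 3 * ((1 - b\<^sup>2) * (1 + s\<^sup>2))"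
      by (simp add: algebra_simps)
    also have "\<dots> \<le> 1 * E + 1 / K * ((1 - b\<^sup>2) * (1 + s\<^sup>2))"
      using \<epsilon>C E0 b1 by (intro add_mono mult_right_mono mult_nonneg_nonneg) auto
    finally have "\<epsilon> * (\<Sum>n<N. (norm (taylor_coeff f (n + 2)))\<^sup>2 * w (n + 2)) \<le> E + (1 - b\<^sup>2) * (1 + s\<^sup>2) / K"
      by simp
    with deficit have "b\<^sup>2 + (norm (taylor_coeff f 1))\<^sup>2 / \<alpha> + \<epsilon> * (\<Sum>n<N. (norm (taylor_coeff f (n + 2)))\<^sup>2 * w (n + 2)) \<le> S powr \<alpha>"
      unfolding E_def by linarith
    then show "(norm (B 0))\<^sup>2 + (norm (taylor_coeff (\<lambda>z. B z * exp (of_real \<alpha> * l z)) 1))\<^sup>2 / \<alpha>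
       + \<epsilon> * weighted_tail (\<alpha> - 1) N (\<lambda>z. B z * exp (of_real \<alpha> * l z))
     \<le> circle_mean (\<lambda>z. (norm (exp (l z)))\<^sup>2) powr \<alpha>"
      unfolding b_def f_def g_def S_def w2 weighted_tail_def .
  qed
qed

text \<open>For \<open>p < 2\<close> factor \<open>F = B G\<close>.  On the circle \<open>|F|\<^sup>p\<close> equals \<open>|c|\<^sup>p |h|\<^sup>2\<close>, since \<open>|B| = 1\<close> there and
  \<open>G\<close> is \<open>c\<close> times the power of \<open>h = exp l\<close> with exponent \<open>2 / p\<close>; this turns the \<open>H\<^sup>p\<close> norm into an \<open>H\<^sup>2\<close> norm.\<close>

lemma inequality_nonvanishing_on_circle:
  fixes p :: real
  assumes p: "0 < p" "p \<le> 2"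
  shows "\<exists>\<epsilon>>0. \<forall>F \<rho> N. F holomorphic_on ball 0 \<rho> \<longrightarrow> 1 < \<rho> \<longrightarrow> (\<forall>z. norm z = 1 \<longrightarrow> F z \<noteq> 0) \<longrightarrow>
     (norm (taylor_coeff F 0))\<^sup>2 + p / 2 * (norm (taylor_coeff F 1))\<^sup>2
       + \<epsilon> * weighted_tail (2 / p - 1) N F
     \<le> circle_mean (\<lambda>z. norm (F z) powr p) powr (2 / p)"
proof (cases "p = 2")
  case True
  show ?thesis
  proof (intro exI[of _ "1 :: real"] conjI allI impI)
    fix F :: "complex \<Rightarrow> complex" and \<rho> :: real and N
    assume F: "F holomorphic_on ball 0 \<rho>" "1 < \<rho>"
    have "(\<Sum>n<Suc (Suc N). (norm (taylor_coeff F n))\<^sup>2) \<le> circle_mean (\<lambda>z. (norm (F z))\<^sup>2)"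
      using parseval_unit[OF F] sum_le_suminf[of "\<lambda>n. (norm (taylor_coeff F n))\<^sup>2" "{..<Suc (Suc N)}"]
      by (simp add: sums_iff)
    moreover have "circle_mean (\<lambda>z. (norm (F z))\<^sup>2) \<ge> 0" by (intro circle_mean_nonneg) auto
    ultimately show "(norm (taylor_coeff F 0))\<^sup>2 + p / 2 * (norm (taylor_coeff F 1))\<^sup>2
       + 1 * weighted_tail (2 / p - 1) N F
     \<le> circle_mean (\<lambda>z. norm (F z) powr p) powr (2 / p)"
      unfolding sum.lessThan_Suc_shift True weighted_tail_def by (simp add: add.assoc powr_numeral)
  qed simp
next
  case False
  define \<alpha> where "\<alpha> = 2 / p"
  have \<alpha>: "1 < \<alpha>" using p False by (simp add: \<alpha>_def)
  from factored_inequality[OF \<alpha>] obtain \<epsilon> where \<epsilon>: "\<epsilon> > 0" "\<forall>B l \<rho> N. B holomorphic_on ball 0 \<rho> \<longrightarrow> 1 < \<rho> \<longrightarrow> (\<forall>z. norm z = 1 \<longrightarrow> norm (B z) \<le> 1) \<longrightarrow>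
       l holomorphic_on ball 0 \<rho> \<longrightarrow> l 0 = 0 \<longrightarrow>
     (norm (B 0))\<^sup>2 + (norm (taylor_coeff (\<lambda>z. B z * exp (of_real \<alpha> * l z)) 1))\<^sup>2 / \<alpha>
       + \<epsilon> * weighted_tail (\<alpha> - 1) N (\<lambda>z. B z * exp (of_real \<alpha> * l z))
     \<le> circle_mean (\<lambda>z. (norm (exp (l z)))\<^sup>2) powr \<alpha>"
    by (elim exE conjE)
  show ?thesis
  proof (intro exI[of _ \<epsilon>] conjI allI impI \<epsilon>(1))
    fix F :: "complex \<Rightarrow> complex" and \<rho> :: real and N
    assume F: "F holomorphic_on ball 0 \<rho>" "1 < \<rho>" and F_nz: "\<forall>z. norm z = 1 \<longrightarrow> F z \<noteq> 0"
    obtain B G \<sigma> where BG: "1 < \<sigma>" "\<sigma> \<le> \<rho>" "B holomorphic_on ball 0 \<sigma>" "G holomorphic_on ball 0 \<sigma>"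
      "\<And>z. norm z < \<sigma> \<Longrightarrow> F z = B z * G z" "\<And>z. norm z = 1 \<Longrightarrow> norm (B z) = 1"
      "\<And>z. norm z < \<sigma> \<Longrightarrow> G z \<noteq> 0"
      using blaschke_factorization[OF F F_nz[rule_format]] by metis
    obtain L where L: "L holomorphic_on ball 0 \<sigma>" "\<And>z. z \<in> ball 0 \<sigma> \<Longrightarrow> exp (L z) = G z"
      by (rule holomorphic_logarithm_exists[of "ball 0 \<sigma>" G 0]) (use BG in auto)
    define l where "l z = (L z - L 0) / of_real \<alpha>" for z
    define c where "c = G 0"
    define f where "f z = B z * exp (of_real \<alpha> * l z)" for z
    define S where "S = circle_mean (\<lambda>z. (norm (exp (l z)))\<^sup>2)"
    have l: "l holomorphic_on ball 0 \<sigma>" "l 0 = 0"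
      unfolding l_def using \<alpha> by (auto intro!: holomorphic_intros L)
    have f: "f holomorphic_on ball 0 \<sigma>" unfolding f_def by (intro holomorphic_intros BG l)
    have G: "G z = c * exp (of_real \<alpha> * l z)" if "norm z < \<sigma>" for z
      using L(2)[of z] L(2)[of 0] that BG(1) BG(7)[of 0] \<alpha> by (simp add: l_def c_def exp_diff)
    have Ff: "F z = c * f z" if "norm z < \<sigma>" for z
      using BG(5)[OF that] G[OF that] by (simp add: f_def)
    have coeff: "taylor_coeff F n = c * taylor_coeff f n" for n
    proof -
      have "taylor_coeff F n = taylor_coeff (\<lambda>z. c * f z) n"
        using Ff BG(1) by (intro taylor_coeff_cong[of \<sigma>]) auto
      then show ?thesis using taylor_coeff_cmult[OF f] BG(1) by simp
    qed
    have mean: "circle_mean (\<lambda>z. norm (F z) powr p) powr (2 / p) = (norm c)\<^sup>2 * S powr \<alpha>"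
    proof -
      have "circle_mean (\<lambda>z. norm (F z) powr p) = circle_mean (\<lambda>z. norm c powr p * (norm (exp (l z)))\<^sup>2)"
      proof (rule circle_mean_cong)
        fix z :: complex assume z: "norm z = 1"
        have "norm (F z) = norm c * norm (exp (l z)) powr \<alpha>"
          using Ff[of z] z BG(1) BG(6)[OF z]
          by (simp only: f_def norm_mult norm_exp_of_real_mult mult_1_left)
        moreover have "(norm (exp (l z)) powr \<alpha>) powr p = (norm (exp (l z)))\<^sup>2"
          using p by (simp add: powr_powr \<alpha>_def powr_numeral)
        ultimately show "norm (F z) powr p = norm c powr p * (norm (exp (l z)))\<^sup>2"
          by (simp only: powr_mult)
      qed
      also have "\<dots> = norm c powr p * S" by (simp add: circle_mean_cmult S_def)
      finally have "circle_mean (\<lambda>z. norm (F z) powr p) powr (2 / p) = (norm c powr p * S) powr (2 / p)"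
        by simp
      also have "\<dots> = (norm c powr p) powr (2 / p) * S powr \<alpha>"
        by (simp add: powr_mult \<alpha>_def)
      also have "(norm c powr p) powr (2 / p) = (norm c)\<^sup>2"
        using p by (simp add: powr_powr powr_numeral)
      finally show ?thesis .
    qed
    have "(norm (B 0))\<^sup>2 + (norm (taylor_coeff f 1))\<^sup>2 / \<alpha>
       + \<epsilon> * weighted_tail (\<alpha> - 1) N f \<le> S powr \<alpha>"
      unfolding f_def S_def using BG(6) by (intro \<epsilon>(2)[rule_format, OF BG(3,1) _ l]) auto
    then have "(norm c)\<^sup>2 * ((norm (B 0))\<^sup>2 + (norm (taylor_coeff f 1))\<^sup>2 / \<alpha>
       + \<epsilon> * weighted_tail (\<alpha> - 1) N f) \<le> (norm c)\<^sup>2 * S powr \<alpha>"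
      by (intro mult_left_mono) auto
    moreover have "B 0 = taylor_coeff f 0" by (simp add: taylor_coeff_0 f_def l)
    ultimately show "(norm (taylor_coeff F 0))\<^sup>2 + p / 2 * (norm (taylor_coeff F 1))\<^sup>2
       + \<epsilon> * weighted_tail (2 / p - 1) N F
     \<le> circle_mean (\<lambda>z. norm (F z) powr p) powr (2 / p)"
      unfolding mean weighted_tail_def coeff norm_mult power_mult_distrib
      by (simp add: \<alpha>_def sum_distrib_left algebra_simps)
  qed
qed

section \<open>Approaching the unit circle\<close>

text \<open>A nonzero \<open>f\<close> has finitely many zeros in each smaller closed disc, so there are radii \<open>r\<close> arbitrarily
  close to \<open>1\<close> for which the dilate \<open>f (r z)\<close> has no zeros on the unit circle.  Its finite sums
  depend continuously on \<open>r\<close>.\<close>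

lemma inequality_partial_sums:
  fixes p \<epsilon> :: real
  assumes p: "0 < p"
    and ineq: "\<forall>F \<rho> N. F holomorphic_on ball 0 \<rho> \<longrightarrow> 1 < \<rho> \<longrightarrow> (\<forall>z. norm z = 1 \<longrightarrow> F z \<noteq> 0) \<longrightarrow>
     (norm (taylor_coeff F 0))\<^sup>2 + p / 2 * (norm (taylor_coeff F 1))\<^sup>2
       + \<epsilon> * weighted_tail (2 / p - 1) N F
     \<le> circle_mean (\<lambda>z. norm (F z) powr p) powr (2 / p)"
    and f: "f \<in> hardy_space p"
  shows "(norm (taylor_coeff f 0))\<^sup>2 + p / 2 * (norm (taylor_coeff f 1))\<^sup>2
       + \<epsilon> * weighted_tail (2 / p - 1) N f \<le> (hardy_norm p f)\<^sup>2"
proof -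
  have fh: "f holomorphic_on ball 0 1" and bdd: "bdd_above (hardy_mean p f ` {0<..<1})"
    using f by (auto simp: hardy_space_def)
  define P where "P r = (norm (taylor_coeff f 0))\<^sup>2 + p / 2 * (norm (of_real (r ^ 1) * taylor_coeff f 1))\<^sup>2
       + \<epsilon> * (\<Sum>n<N. (norm (of_real (r ^ (n + 2)) * taylor_coeff f (n + 2)))\<^sup>2 * real (n + 3) powr (-(2 / p - 1)))" for r :: real
  have le: "hardy_mean p f r \<le> hardy_norm p f" if "r \<in> {0<..<1}" for r
    unfolding hardy_norm_def by (intro cSUP_upper that bdd)
  have sq: "(hardy_mean p f r)\<^sup>2 \<le> (hardy_norm p f)\<^sup>2" if "r \<in> {0<..<1}" for r
    using le[OF that] by (intro power_mono) (auto simp: hardy_mean_def)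
  have "\<exists>r\<in>{s<..<1}. P r \<le> (hardy_norm p f)\<^sup>2" if s: "0 < s" "s < 1" for s
  proof (cases "\<forall>z\<in>ball 0 1. f z = 0")
    case True
    then have "taylor_coeff f n = 0" for n
      using taylor_coeff_cong[of 1 f "\<lambda>_. 0" n] by (simp add: taylor_coeff_const)
    moreover obtain r where "s < r" "r < 1" using s dense by blast
    ultimately show ?thesis by (intro bexI[of _ r]) (auto simp: P_def)
  next
    case False
    define t where "t = (s + 1) / 2"
    have t: "s < t" "t < 1" using s by (auto simp: t_def)
    have "finite {z\<in>cball 0 t. f z = 0}"
    proof (cases "f constant_on ball 0 1")
      case True
      then have "{z\<in>cball 0 t. f z = 0} = {}" using False t unfolding constant_on_def by fastforce
      then show ?thesis by (simp only: finite.emptyI)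
    next
      case nc: False
      show ?thesis
        by (rule holomorphic_compact_finite_zeros[OF fh _ _ _ _ nc]) (use t in auto)
    qed
    then have "finite (norm ` {z\<in>cball 0 t. f z = 0})" by (rule finite_imageI)
    moreover have "infinite {s<..<t}" using t by (simp add: infinite_Ioo)
    ultimately obtain r where r: "r \<in> {s<..<t}" "r \<notin> norm ` {z\<in>cball 0 t. f z = 0}"
      by (meson finite_subset subsetI)
    define F where "F z = f (of_real r * z)" for z
    have r01: "0 < r" "r < 1" using r s t by auto
    have "F holomorphic_on ball 0 (1 / r)"
      unfolding F_def
      by (rule holomorphic_on_compose_gen[OF _ fh, unfolded o_def])
         (use r01 in \<open>auto intro!: holomorphic_intros simp: norm_mult field_simps\<close>)
    moreover have "F z \<noteq> 0" if "norm z = 1" for z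
      using r r01 that unfolding F_def by (auto simp: image_iff norm_mult)
    moreover have "taylor_coeff F n = of_real (r ^ n) * taylor_coeff f n" for n
      unfolding F_def[abs_def] using r01 by (intro taylor_coeff_dilate[OF fh]) auto
    ultimately have "P r \<le> circle_mean (\<lambda>z. norm (F z) powr p) powr (2 / p)"
      using ineq[rule_format, of F "1 / r" N] r01 unfolding P_def weighted_tail_def by simp
    also have "\<dots> = (hardy_mean p f r)\<^sup>2"
      using p by (simp add: hardy_mean_eq F_def powr_powr flip: powr_numeral)
    also have "\<dots> \<le> (hardy_norm p f)\<^sup>2" using r01 by (intro sq) auto
    finally show ?thesis using r01 r by (intro bexI[of _ r]) auto
  qed
  then have "\<exists>r. 1 - 1 / real (n + 2) < r \<and> r < 1 \<and> P r \<le> (hardy_norm p f)\<^sup>2" for n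
    by (elim meta_allE[of _ "1 - 1 / real (n + 2)"]) (auto simp: field_simps)
  then obtain r where r: "\<And>n. 1 - 1 / real (n + 2) < r n" "\<And>n. r n < 1" "\<And>n. P (r n) \<le> (hardy_norm p f)\<^sup>2"
    by metis
  have "r \<longlonglongrightarrow> 1"
  proof (rule tendsto_sandwich)
    show "(\<lambda>n. 1 - 1 / real (n + 2)) \<longlonglongrightarrow> 1" by real_asymp
    show "\<forall>\<^sub>F n in sequentially. 1 - 1 / real (n + 2) \<le> r n" using r(1) by (simp add: less_imp_le)
    show "\<forall>\<^sub>F n in sequentially. r n \<le> 1" using r(2) by (simp add: less_imp_le)
  qed auto
  then have "(\<lambda>n. P (r n)) \<longlonglongrightarrow> P 1"
    unfolding P_def by (intro tendsto_intros)
  then have "P 1 \<le> (hardy_norm p f)\<^sup>2"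
    by (rule LIMSEQ_le_const2) (use r(3) in auto)
  then show ?thesis by (simp add: P_def weighted_tail_def)
qed

theorem theorem1p3:
  fixes p :: real
  assumes "0 < p" and "p \<le> 2"
  shows "\<exists>\<epsilon>::real. \<epsilon> > 0 \<and>
    (\<forall>f \<in> hardy_space p.
       (\<lambda>n::nat. (norm (taylor_coeff f n))\<^sup>2 / real (n + 1) powr (2 / p - 1)) summable_on {2..} \<and>
       (norm (taylor_coeff f 0))\<^sup>2 + p / 2 * (norm (taylor_coeff f 1))\<^sup>2
         + \<epsilon> * (\<Sum>\<^sub>\<infinity>n\<in>{2..}. (norm (taylor_coeff f n))\<^sup>2 / real (n + 1) powr (2 / p - 1))
       \<le> (hardy_norm p f)\<^sup>2)"
proof -
  from inequality_nonvanishing_on_circle[OF assms] obtain \<epsilon> where \<epsilon>: "\<epsilon> > 0" "\<forall>F \<rho> N. F holomorphic_on ball 0 \<rho> \<longrightarrow> 1 < \<rho> \<longrightarrow> (\<forall>z. norm z = 1 \<longrightarrow> F z \<noteq> 0) \<longrightarrow>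
     (norm (taylor_coeff F 0))\<^sup>2 + p / 2 * (norm (taylor_coeff F 1))\<^sup>2
       + \<epsilon> * weighted_tail (2 / p - 1) N F
     \<le> circle_mean (\<lambda>z. norm (F z) powr p) powr (2 / p)"
    by (elim exE conjE)
  show ?thesis
  proof (intro exI[of _ \<epsilon>] conjI ballI \<epsilon>(1))
    fix f assume f: "f \<in> hardy_space p"
    define u where "u n = (norm (taylor_coeff f n))\<^sup>2 / real (n + 1) powr (2 / p - 1)" for n
    define A where "A = (norm (taylor_coeff f 0))\<^sup>2 + p / 2 * (norm (taylor_coeff f 1))\<^sup>2"
    have partial: "A + \<epsilon> * (\<Sum>n<N. u (n + 2)) \<le> (hardy_norm p f)\<^sup>2" for N
    proof -
      have "u (n + 2) = (norm (taylor_coeff f (n + 2)))\<^sup>2 * real (n + 3) powr (-(2 / p - 1))" for n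
      proof -
        have "n + 2 + 1 = n + 3" by simp
        then show ?thesis by (simp only: u_def powr_minus_divide times_divide_eq_right mult_1_right)
      qed
      then show ?thesis
        using inequality_partial_sums[OF assms(1) \<epsilon>(2) f, of N] by (simp only: A_def weighted_tail_def)
    qed
    have u0: "u n \<ge> 0" for n by (simp add: u_def)
    have bound: "sum u X \<le> ((hardy_norm p f)\<^sup>2 - A) / \<epsilon>" if X: "finite X" "X \<subseteq> {2..}" for X
    proof -
      obtain N where N: "X \<subseteq> {..<N}" using finite_nat_bounded[OF X(1)] by blast
      have "sum u X \<le> sum u ((\<lambda>n. n + 2) ` {..<N})"
      proof (intro sum_mono2)
        show "X \<subseteq> (\<lambda>n. n + 2) ` {..<N}"
        proof
          fix x assume "x \<in> X"
          then have "x = (x - 2) + 2" "x - 2 < N" using N X(2) by auto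
          then show "x \<in> (\<lambda>n. n + 2) ` {..<N}" by blast
        qed
      qed (auto simp: u0)
      also have "\<dots> = (\<Sum>n<N. u (n + 2))" by (simp add: sum.reindex inj_on_def)
      finally have "\<epsilon> * sum u X \<le> \<epsilon> * (\<Sum>n<N. u (n + 2))" using \<epsilon>(1) by (intro mult_left_mono) auto
      then have "\<epsilon> * sum u X \<le> (hardy_norm p f)\<^sup>2 - A" using partial[of N] by linarith
      then show ?thesis using \<epsilon>(1) by (simp add: pos_le_divide_eq mult.commute)
    qed
    have sm: "u summable_on {2..}"
      by (rule nonneg_bdd_above_summable_on) (use u0 bound in \<open>auto intro!: bdd_aboveI\<close>)
    then show "(\<lambda>n. (norm (taylor_coeff f n))\<^sup>2 / real (n + 1) powr (2 / p - 1)) summable_on {2..}"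
      by (simp add: u_def[abs_def])
    have "infsum u {2..} \<le> ((hardy_norm p f)\<^sup>2 - A) / \<epsilon>"
      by (intro infsum_le_finite_sums sm bound)
    then have "A + \<epsilon> * infsum u {2..} \<le> (hardy_norm p f)\<^sup>2"
      using \<epsilon>(1) by (simp add: field_simps)
    then show "(norm (taylor_coeff f 0))\<^sup>2 + p / 2 * (norm (taylor_coeff f 1))\<^sup>2
         + \<epsilon> * (\<Sum>\<^sub>\<infinity>n\<in>{2..}. (norm (taylor_coeff f n))\<^sup>2 / real (n + 1) powr (2 / p - 1))
       \<le> (hardy_norm p f)\<^sup>2"
      by (simp add: A_def u_def[abs_def])
  qed
qed

end
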